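(* Let $N\ge 0$ be an integer, $h>0$, $\omega\in\mathbb{R}$, $\Omega=\omega h$, and $\alpha\in\mathbb{R}$. Let $\lambda\in\mathbb{C}\setminus\{0\}$. There exists a non-trivial Bloch wave solution $$u_h(x,t)=\mathrm{e}^{-i\omega t}\sum_{m\in\mathbb{Z}}\lambda^m U(x-mh),\qquad \phi_h(x,t)=\mathrm{e}^{-i\omega t}\sum_{m\in\mathbb{Z}}\lambda^m \Phi(x-mh)$$ of the DG scheme with parameter $\alpha$ (defined in the context) if and only if $\lambda$ is a root of the algebraic equation $$\frac1{\lambda^2}\det(M(\lambda))=a_N\left(\lambda+\frac1\lambda\right)^2+b_N\left(\lambda+\frac1\lambda\right)+c_N=0,$$ where $$a_N=(-1)^N(1-\alpha^2)F_N^-F_N^+,$$ $$b_N=-(-1)^N(1-\alpha^2)(F_N^-F_{N+1}^-+F_N^+F_{N+1}^+)+(1+\alpha^2)(F_N^+F_{N+1}^-+F_N^-F_{N+1}^+),$$ $$c_N=2(-1)^N(1-\alpha^2)(F_{N+1}^-F_{N+1}^+-F_N^-F_N^+)-(1+\alpha^2)\big((F_N^-)^2+(F_N^+)^2+(F_{N+1}^-)^2+(F_{N+1}^+)^2\big)$$ are real constants, and $$M(\lambda)=\begin{bmatrix}\lambda F_{N+1}^--F_N^+&\lambda F_N^--F_{N+1}^+&0&0\\0&0&\lambda F_{N+1}^+-F_N^-&\lambda F_N^+-F_{N+1}^-\\ \lambda(-1)^N&-1&-\alpha\lambda&-\alpha(-1)^N\\ \alpha\lambda(-1)^N&\alpha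&-\lambda&(-1)^N\end{bmatrix}.$$
   Context: Mesh and space: $\mathbb{R}$ is partitioned into cells $I_j=((j-\frac12)h,(j+\frac12)h)$, $j\in\mathbb{Z}$, with nodes $x_{j-1/2}=(j-\frac12)h$. Let $V_h^N$ be the space of (complex-valued) functions whose restriction to each $I_j$ is a polynomial of degree at most $N$; global square-integrability is not required for Bloch waves, since the scheme is posed cell by cell. For piecewise polynomial $p$, $p^-_{j-1/2}$ and $p^+_{j-1/2}$ are the limits of $p$ at $x_{j-1/2}$ from the left cell $I_{j-1}$ and the right cell $I_j$; the jump is $[p]_{j-1/2}=p^+_{j-1/2}-p^-_{j-1/2}$ and the mean is $\{p\}_{j-1/2}=\frac12(p^+_{j-1/2}+p^-_{j-1/2})$. DG scheme with parameter $\alpha$: $u_h(\cdot,t),\phi_h(\cdot,t)\in V_h^N$ satisfy, for all $j\in\mathbb{Z}$ and all $v,\psi\in V_h^N$, $$\int_{I_j}(u_h)_t v\,dx-\int_{I_j}u_h v_x\,dx+\widehat u_{j+1/2}v^-_{j+1/2}-\widehat u_{j-1/2}v^+_{j-1/2}=0,$$ $$\int_{I_j}(\phi_h)_t \psi\,dx+\int_{I_j}\phi_h \psi_x\,dx-\widehat \phi_{j+1/2}\psi^-_{j+1/2}+\widehat \phi_{j-1/2}\psi^+_{j-1/2}=0,$$ with numerical fluxes $\widehat u_{j-1/2}=\{u_h\}_{j-1/2}+\frac12\alpha[\phi_h]_{j-1/2}$ and $\widehat\phi_{j-1/2}=\{\phi_h\}_{j-1/2}+\frac12\alpha[u_h]_{j-1/2}$.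 In a Bloch wave solution, $U,\Phi$ are polynomials of degree at most $N$ on the cell $I_0$, extended by zero outside $I_0$; non-trivial means $(U,\Phi)\ne(0,0)$. Equivalent eigenvalue problem: after mapping $I_0$ to $[-1,1]$, the existence of such a solution means that there are $(U,\Phi)\ne(0,0)$, polynomials of degree at most $N$ on $[-1,1]$, such that for all polynomials $v,\psi$ of degree at most $N$, with $(f,g)=\int_{-1}^1 fg\,ds$, $$-\tfrac12 i\Omega(U,v)+(U',v)+\tfrac12\big(\lambda U(-1)-U(1)+\alpha(\lambda\Phi(-1)-\Phi(1))\big)v(1)+\tfrac12\big(U(-1)-\lambda^{-1}U(1)-\alpha(\Phi(-1)-\lambda^{-1}\Phi(1))\big)v(-1)=0,$$ $$\tfrac12 i\Omega(\Phi,\psi)+(\Phi',\psi)+\tfrac12\big(\lambda \Phi(-1)-\Phi(1)+\alpha(\lambda U(-1)-U(1))\big)\psi(1)+\tfrac12\big(\Phi(-1)-\lambda^{-1}\Phi(1)-\alpha(U(-1)-\lambda^{-1}U(1))\big)\psi(-1)=0.$$ Constants: ${}_1F_1(a,b,z)=\sum_{m\ge0}\frac{(a)_m}{(b)_m}\frac{z^m}{m!}$ with $(a)_0=1$, $(a)_m=a(a+1)\cdots(a+m-1)$; when $a$ is a non-positive integer the series is understood to terminate at $m=-a$. Set $$F_N^\pm={}_1F_1(-N,-2N-1,\pm i\Omega),\qquad F_{N+1}^\pm={}_1F_1(-N-1,-2N-1,\pm i\Omega)$$ (note that $F_{N+1}^\pm$ also has second parameter $-2N-1$). *)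

theory Defs
  imports "HOL-Analysis.Analysis" "HOL-Computational_Algebra.Polynomial"
begin

text \<open>The node x_{j-1/2} is written \<open>node h j\<close>; hence x_{j+1/2} is \<open>node h (j + 1)\<close>.\<close>

definition node :: "real \<Rightarrow> int \<Rightarrow> real" where
  "node h j = (of_int j - 1/2) * h"

definition cell :: "real \<Rightarrow> int \<Rightarrow> real set" where
  "cell h j = {node h j <..< node h (j + 1)}"

text \<open>The broken polynomial space V_h^N. The cells are open, so the values at the nodes are
  unconstrained; only one-sided limits are ever taken there.\<close>

definition dg_space :: "real \<Rightarrow> nat \<Rightarrow> (real \<Rightarrow> complex) set" where
  "dg_space h N =
     {f. \<forall>j. \<exists>p :: complex poly. degree p \<le> N \<and> (\<forall>x\<in>cell h j. f x = poly p (of_real x))}"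

definition left_trace :: "(real \<Rightarrow> complex) \<Rightarrow> real \<Rightarrow> complex" where
  "left_trace f x = Lim (at_left x) f"

definition right_trace :: "(real \<Rightarrow> complex) \<Rightarrow> real \<Rightarrow> complex" where
  "right_trace f x = Lim (at_right x) f"

definition jump :: "(real \<Rightarrow> complex) \<Rightarrow> real \<Rightarrow> complex" where
  "jump f x = right_trace f x - left_trace f x"

definition mean :: "(real \<Rightarrow> complex) \<Rightarrow> real \<Rightarrow> complex" where
  "mean f x = (right_trace f x + left_trace f x) / 2"

text \<open>The flux of u is \<open>flux \<alpha> u \<phi>\<close> and, with the roles exchanged, that of \<open>\<phi>\<close> is \<open>flux \<alpha> \<phi> u\<close>.\<close>

definition flux :: "real \<Rightarrow> (real \<Rightarrow> complex) \<Rightarrow> (real \<Rightarrow> complex) \<Rightarrow> real \<Rightarrow> complex" where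
  "flux \<alpha> f g x = mean f x + 1/2 * of_real \<alpha> * jump g x"

definition time_deriv :: "(real \<Rightarrow> real \<Rightarrow> complex) \<Rightarrow> real \<Rightarrow> real \<Rightarrow> complex" where
  "time_deriv u x t = vector_derivative (\<lambda>s. u x s) (at t)"

definition space_deriv :: "(real \<Rightarrow> complex) \<Rightarrow> real \<Rightarrow> complex" where
  "space_deriv v x = vector_derivative v (at x)"

text \<open>Differentiability in time is required explicitly, since \<open>vector_derivative\<close> is total.\<close>

definition dg_solution ::
  "real \<Rightarrow> nat \<Rightarrow> real \<Rightarrow> (real \<Rightarrow> real \<Rightarrow> complex) \<Rightarrow> (real \<Rightarrow> real \<Rightarrow> complex) \<Rightarrow> bool" where
  "dg_solution h N \<alpha> u \<phi> \<longleftrightarrow>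
     (\<forall>t. (\<lambda>x. u x t) \<in> dg_space h N \<and> (\<lambda>x. \<phi> x t) \<in> dg_space h N) \<and>
     (\<forall>t j. \<forall>x\<in>cell h j.
        (\<lambda>s. u x s) differentiable (at t) \<and> (\<lambda>s. \<phi> x s) differentiable (at t)) \<and>
     (\<forall>t j. \<forall>v\<in>dg_space h N. \<forall>\<psi>\<in>dg_space h N.
        integral (cell h j) (\<lambda>x. time_deriv u x t * v x)
          - integral (cell h j) (\<lambda>x. u x t * space_deriv v x)
          + flux \<alpha> (\<lambda>x. u x t) (\<lambda>x. \<phi> x t) (node h (j + 1)) * left_trace v (node h (j + 1))
          - flux \<alpha> (\<lambda>x. u x t) (\<lambda>x. \<phi> x t) (node h j) * right_trace v (node h j) = 0 \<and>
        integral (cell h j) (\<lambda>x. time_deriv \<phi> x t * \<psi> x)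
          + integral (cell h j) (\<lambda>x. \<phi> x t * space_deriv \<psi> x)
          - flux \<alpha> (\<lambda>x. \<phi> x t) (\<lambda>x. u x t) (node h (j + 1)) * left_trace \<psi> (node h (j + 1))
          + flux \<alpha> (\<lambda>x. \<phi> x t) (\<lambda>x. u x t) (node h j) * right_trace \<psi> (node h j) = 0)"

text \<open>Polynomials of degree at most N on the reference cell, extended by zero.\<close>

definition cell_poly :: "real \<Rightarrow> nat \<Rightarrow> (real \<Rightarrow> complex) set" where
  "cell_poly h N =
     {U. \<exists>p :: complex poly. degree p \<le> N \<and>
           U = (\<lambda>x. if x \<in> cell h 0 then poly p (of_real x) else 0)}"

text \<open>For \<open>U \<in> cell_poly h N\<close> and \<open>h > 0\<close> at most one term of the sum is non-zero at each \<open>x\<close>.\<close>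

definition bloch_wave ::
  "real \<Rightarrow> real \<Rightarrow> complex \<Rightarrow> (real \<Rightarrow> complex) \<Rightarrow> real \<Rightarrow> real \<Rightarrow> complex" where
  "bloch_wave h \<omega> l U x t =
     exp (- \<i> * of_real \<omega> * of_real t) * (\<Sum>\<^sub>\<infinity>m::int. l powi m * U (x - of_int m * h))"

text \<open>Kummer's series. If \<open>a\<close> is a non-positive integer, \<open>pochhammer a m = 0\<close> for all
  \<open>m > - a\<close>; since division by zero yields zero, the series then terminates at \<open>m = - a\<close> even
  where \<open>pochhammer b m\<close> vanishes.\<close>

definition hyp1F1 :: "complex \<Rightarrow> complex \<Rightarrow> complex \<Rightarrow> complex" where
  "hyp1F1 a b z = (\<Sum>m. pochhammer a m / pochhammer b m * (z ^ m / fact m))"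

text \<open>Here \<open>Fp\<close>, \<open>Fm\<close> stand for F_N^+, F_N^- and \<open>Gp\<close>, \<open>Gm\<close> for F_{N+1}^+, F_{N+1}^-. The latter
  are not \<open>Fp\<close>, \<open>Fm\<close> at \<open>N + 1\<close>: the second parameter stays \<open>- 2 N - 1\<close>.\<close>

definition Fp :: "nat \<Rightarrow> real \<Rightarrow> complex" where
  "Fp N \<Omega> = hyp1F1 (- of_nat N) (- 2 * of_nat N - 1) (\<i> * of_real \<Omega>)"

definition Fm :: "nat \<Rightarrow> real \<Rightarrow> complex" where
  "Fm N \<Omega> = hyp1F1 (- of_nat N) (- 2 * of_nat N - 1) (- \<i> * of_real \<Omega>)"

definition Gp :: "nat \<Rightarrow> real \<Rightarrow> complex" where
  "Gp N \<Omega> = hyp1F1 (- of_nat N - 1) (- 2 * of_nat N - 1) (\<i> * of_real \<Omega>)"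

definition Gm :: "nat \<Rightarrow> real \<Rightarrow> complex" where
  "Gm N \<Omega> = hyp1F1 (- of_nat N - 1) (- 2 * of_nat N - 1) (- \<i> * of_real \<Omega>)"

definition coef_a :: "nat \<Rightarrow> real \<Rightarrow> real \<Rightarrow> complex" where
  "coef_a N \<alpha> \<Omega> = (-1) ^ N * (1 - (of_real \<alpha>)\<^sup>2) * Fm N \<Omega> * Fp N \<Omega>"

definition coef_b :: "nat \<Rightarrow> real \<Rightarrow> real \<Rightarrow> complex" where
  "coef_b N \<alpha> \<Omega> =
     - ((-1) ^ N) * (1 - (of_real \<alpha>)\<^sup>2) * (Fm N \<Omega> * Gm N \<Omega> + Fp N \<Omega> * Gp N \<Omega>)
     + (1 + (of_real \<alpha>)\<^sup>2) * (Fp N \<Omega> * Gm N \<Omega> + Fm N \<Omega> * Gp N \<Omega>)"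

definition coef_c :: "nat \<Rightarrow> real \<Rightarrow> real \<Rightarrow> complex" where
  "coef_c N \<alpha> \<Omega> =
     2 * (-1) ^ N * (1 - (of_real \<alpha>)\<^sup>2) * (Gm N \<Omega> * Gp N \<Omega> - Fm N \<Omega> * Fp N \<Omega>)
     - (1 + (of_real \<alpha>)\<^sup>2) * ((Fm N \<Omega>)\<^sup>2 + (Fp N \<Omega>)\<^sup>2 + (Gm N \<Omega>)\<^sup>2 + (Gp N \<Omega>)\<^sup>2)"

definition bloch_matrix :: "nat \<Rightarrow> real \<Rightarrow> real \<Rightarrow> complex \<Rightarrow> complex ^ 4 ^ 4" where
  "bloch_matrix N \<alpha> \<Omega> l = vector
     [vector [l * Gm N \<Omega> - Fp N \<Omega>, l * Fm N \<Omega> - Gp N \<Omega>, 0, 0],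
      vector [0, 0, l * Gp N \<Omega> - Fm N \<Omega>, l * Fp N \<Omega> - Gm N \<Omega>],
      vector [l * (-1) ^ N, -1, - of_real \<alpha> * l, - of_real \<alpha> * (-1) ^ N],
      vector [of_real \<alpha> * l * (-1) ^ N, of_real \<alpha>, - l, (-1) ^ N]]"

end

theory Submission
  imports Defs
begin

text \<open>Mapping a cell to \<open>[0, 1]\<close>, the scheme for \<open>U\<close> becomes \<open>U' - z U + a kernel1 + b kernel0 = 0\<close> with
  \<open>z = i \<Omega>\<close>, where \<open>kernel0\<close>, \<open>kernel1\<close> represent evaluation at the end points and \<open>a\<close>, \<open>b\<close> are the
  differences between the numerical fluxes and the traces; for \<open>\<Phi>\<close> the sign of \<open>z\<close> is reversed. If
  \<open>z \<noteq> 0\<close>, a truncated Neumann series solves for \<open>U\<close> in terms of \<open>a\<close> and \<open>b\<close>, and its end point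
  values are the numerators and denominators of the subdiagonal Pade approximants of \<open>exp\<close>, that is,
  the values of 1F1. The right flux is \<open>\<lambda>\<close> times the left one, which gives the first two rows of
  \<open>M(\<lambda>)\<close>; the definition of the fluxes gives the last two. If \<open>z = 0\<close>, this parametrisation
  degenerates, and the equation is solved directly by Legendre polynomials.\<close>

subsection \<open>The reference cell\<close>

lemma poly_of_real_has_vector_derivative:
  "((\<lambda>x. poly p (of_real x)) has_vector_derivative poly (pderiv p) (of_real x)) (at x within S)"
  for p :: "complex poly"
  by (rule has_vector_derivative_real_field) (rule poly_DERIV)

lemma poly_of_real_continuous_on: "continuous_on S (\<lambda>x::real. poly p (of_real x :: complex))"
  by (intro continuous_intros)

lemma pderiv_has_integral:
  fixes p :: "complex poly" and a b :: real
  assumes "a \<le> b"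
  shows "((\<lambda>x. poly (pderiv p) (of_real x)) has_integral (poly p (of_real b) - poly p (of_real a))) {a..b}"
  by (rule fundamental_theorem_of_calculus[OF assms]) (rule poly_of_real_has_vector_derivative)


text \<open>The reference cell is [0, 1], so that derivatives at its left end are coefficients up to
  factorials.\<close>

definition unit_integral :: "complex poly \<Rightarrow> complex" where
  "unit_integral p = integral {0..1} (\<lambda>x. poly p (of_real x))"

lemma unit_integral_pderiv: "unit_integral (pderiv p) = poly p 1 - poly p 0"
  using integral_unique[OF pderiv_has_integral[of 0 1 p]] by (simp add: unit_integral_def)

lemma unit_integral_add: "unit_integral (p + q) = unit_integral p + unit_integral q"
  unfolding unit_integral_def poly_add
  by (intro integral_add integrable_continuous_real poly_of_real_continuous_on)

lemma unit_integral_smult: "unit_integral (smult c p) = c * unit_integral p"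
  unfolding unit_integral_def poly_smult by simp

lemma unit_integral_0 [simp]: "unit_integral 0 = 0"
  by (simp add: unit_integral_def)

lemma unit_integral_uminus: "unit_integral (- p) = - unit_integral p"
  using unit_integral_smult[of "-1" p] by simp

lemma unit_integral_diff: "unit_integral (p - q) = unit_integral p - unit_integral q"
  using unit_integral_add[of p "- q"] by (simp add: unit_integral_uminus)

lemma unit_integral_parts: "unit_integral (pderiv p * w) = poly p 1 * poly w 1 - poly p 0 * poly w 0 - unit_integral (p * pderiv w)"
proof -
  have "unit_integral (pderiv (p * w)) = poly p 1 * poly w 1 - poly p 0 * poly w 0"
    by (simp add: unit_integral_pderiv)
  then show ?thesis
    by (simp add: pderiv_mult unit_integral_add algebra_simps)
qed

text \<open>The pairing is bilinear, so \<open>q\<close> is tested against its coefficientwise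
  conjugate, which on real arguments gives the integral of |q|^2. Its continuous integrand must
  vanish, and \<open>q\<close> has infinitely many roots.\<close>

lemma unit_integral_orthogonal_imp_zero:
  assumes "degree q \<le> N" and orth: "\<And>w. degree w \<le> N \<Longrightarrow> unit_integral (q * w) = 0"
  shows "q = 0"
proof -
  let ?w = "map_poly cnj q"
  have "degree ?w \<le> N"
    using assms(1) map_poly_degree_leq[of cnj q] by simp
  then have 0: "unit_integral (q * ?w) = 0"
    by (rule orth)
  have w: "poly ?w (of_real x) = cnj (poly q (of_real x))" for x :: real
    by (metis complex_cnj_complex_of_real complex_cnj_cnj poly_cnj)
  have cont: "continuous_on {0..1} (\<lambda>x::real. (cmod (poly q (of_real x)))\<^sup>2)"
    by (intro continuous_intros)
  have "unit_integral (q * ?w) = integral {0..1} (\<lambda>x. of_real ((cmod (poly q (of_real x)))\<^sup>2))"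
    unfolding unit_integral_def poly_mult w by (simp only: complex_norm_square)
  also have "\<dots> = of_real (integral {0..1} (\<lambda>x. (cmod (poly q (of_real x)))\<^sup>2))"
    using integral_linear[OF integrable_continuous_real[OF cont] bounded_linear_of_real]
    by (simp add: o_def)
  finally have "integral {0..1} (\<lambda>x. (cmod (poly q (of_real x)))\<^sup>2) = 0"
    using 0 by simp
  then have "\<forall>x\<in>{0..1::real}. (cmod (poly q (of_real x)))\<^sup>2 = 0"
    using integral_eq_0_iff[OF cont] by simp
  then have "complex_of_real ` {0..1} \<subseteq> {x. poly q x = 0}"
    by auto
  moreover have "infinite (complex_of_real ` {0..1})"
    by (subst finite_image_iff) (auto simp: inj_on_def infinite_Icc)
  ultimately show "q = 0"
    using poly_roots_finite finite_subset by blast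
qed

text \<open>Repeated integration by parts moves all derivatives onto \<open>w\<close>; every
  boundary term vanishes.\<close>

lemma unit_integral_higher_pderiv_eq_0:
  assumes "\<And>j. j < k \<Longrightarrow> poly ((pderiv ^^ j) p) 0 = 0 \<and> poly ((pderiv ^^ j) p) 1 = 0"
    and "(pderiv ^^ k) w = 0"
  shows "unit_integral ((pderiv ^^ k) p * w) = 0"
  using assms
proof (induction k arbitrary: w)
  case (Suc k)
  have "unit_integral ((pderiv ^^ k) p * pderiv w) = 0"
    using Suc.prems by (intro Suc.IH) (auto simp: funpow_Suc_right simp del: funpow.simps)
  then show ?case
    using Suc.prems(1)[of k] by (simp add: unit_integral_parts)
qed auto

section \<open>End point derivatives of unnormalised Bernstein polynomials\<close>

definition bernstein :: "nat \<Rightarrow> nat \<Rightarrow> complex poly" where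
  "bernstein m n = monom 1 m * [:1, -1:] ^ n"

lemma coeff_one_minus_power: "coeff ([:1, -1:] ^ n) j = (-1) ^ j * (of_nat (n choose j) :: complex)"
proof (cases "j \<le> n")
  case True
  then show ?thesis by (simp add: coeff_linear_poly_power mult.commute)
next
  case False
  have "degree ([:1, -1 :: complex:] ^ n) \<le> degree [:1, -1 :: complex:] * n"
    by (rule degree_power_le)
  then show ?thesis using False by (simp add: coeff_eq_0)
qed

lemma poly_higher_pderiv_at_0: "poly ((pderiv ^^ k) p) 0 = fact k * coeff p k"
  for p :: "complex poly"
  by (simp add: poly_0_coeff_0 coeff_higher_pderiv pochhammer_fact)

lemma bernstein_at_0:
  "poly ((pderiv ^^ (m + j)) (bernstein m n)) 0 = fact (m + j) * (-1) ^ j * of_nat (n choose j)"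
  by (simp add: poly_higher_pderiv_at_0 bernstein_def coeff_monom_mult coeff_one_minus_power)

lemma bernstein_at_0_less: "k < m \<Longrightarrow> poly ((pderiv ^^ k) (bernstein m n)) 0 = 0"
  by (simp add: poly_higher_pderiv_at_0 bernstein_def coeff_monom_mult)

text \<open>Together with \<open>bernstein_reflect\<close>, this reduces derivatives at 1 to
  derivatives at 0, at the cost of one sign per derivative.\<close>

lemma higher_pderiv_reflect:
  "(pderiv ^^ k) (pcompose p [:1, -1:]) = smult ((-1) ^ k) (pcompose ((pderiv ^^ k) p) [:1, -1:])"
  for p :: "complex poly"
  by (induction k) (simp_all add: pderiv_smult pderiv_pcompose pderiv_pCons)

lemma bernstein_reflect: "pcompose (bernstein m n) [:1, -1:] = bernstein n m"
proof -
  have pw: "pcompose (p ^ k) r = pcompose p r ^ k" for p r :: "complex poly" and k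
    by (induction k) (simp_all add: pcompose_mult pcompose_1)
  have "monom 1 m = [:0, 1 :: complex:] ^ m" for m
    by (simp add: monom_altdef)
  then show ?thesis
    by (simp add: bernstein_def pcompose_mult pw pcompose_pCons mult.commute)
qed

lemma bernstein_at_1: "poly ((pderiv ^^ k) (bernstein m n)) 1 = (-1) ^ k * poly ((pderiv ^^ k) (bernstein n m)) 0"
proof -
  have "(pderiv ^^ k) (bernstein m n) = smult ((-1) ^ k) (pcompose ((pderiv ^^ k) (bernstein n m)) [:1, -1:])"
    by (metis bernstein_reflect higher_pderiv_reflect)
  then show ?thesis
    by (simp add: poly_pcompose)
qed

lemma degree_bernstein: "degree (bernstein m n) = m + n"
proof -
  have "degree ([:1, -1 :: complex:] ^ n) = n"
    by (simp add: degree_power_eq)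
  then show ?thesis
    by (simp add: bernstein_def degree_mult_eq degree_monom_eq monom_eq_0_iff)
qed

text \<open>\<open>kernel0\<close> and \<open>kernel1\<close> represent evaluation at 0 and at 1 on polynomials of degree at most N. In
  Rodrigues form this is a repeated integration by parts, all but one of whose boundary terms vanish,
  and their derivatives at both end points are read off binomial coefficients.\<close>

definition kernel0 :: "nat \<Rightarrow> complex poly" where
  "kernel0 N = smult (- 1 / fact N) ((pderiv ^^ Suc N) (bernstein N (Suc N)))"

definition kernel1 :: "nat \<Rightarrow> complex poly" where
  "kernel1 N = smult ((-1) ^ N / fact N) ((pderiv ^^ Suc N) (bernstein (Suc N) N))"

lemma degree_kernel0: "degree (kernel0 N) \<le> N" and degree_kernel1: "degree (kernel1 N) \<le> N"
  by (simp_all add: kernel0_def kernel1_def degree_higher_pderiv degree_bernstein del: funpow.simps)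

text \<open>Only the first integration by parts leaves boundary terms: \<open>m\<close> and
  \<open>n\<close> are at least \<open>N\<close>, so derivatives of order below \<open>N\<close>
  vanish at both ends, and the remaining integral is zero because the \<open>N\<close>-th derivative
  of \<open>pderiv w\<close> is.\<close>

lemma unit_integral_bernstein:
  assumes w: "degree w \<le> N" and "N \<le> m" "N \<le> n"
  shows "unit_integral ((pderiv ^^ Suc N) (bernstein m n) * w)
     = poly ((pderiv ^^ N) (bernstein m n)) 1 * poly w 1 - poly ((pderiv ^^ N) (bernstein m n)) 0 * poly w 0"
proof -
  have "pderiv ((pderiv ^^ N) w) = 0"
    using w by (simp add: pderiv_eq_0_iff degree_higher_pderiv)
  then have "unit_integral ((pderiv ^^ N) (bernstein m n) * pderiv w) = 0"
    using assms by (intro unit_integral_higher_pderiv_eq_0)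
      (auto simp: bernstein_at_0_less bernstein_at_1 funpow_swap1)
  then show ?thesis by (simp add: unit_integral_parts)
qed

text \<open>The zero of order \<open>Suc N\<close> at 1 removes the boundary term there; the one at
  0 is \<open>fact N\<close>, which fixes the normalisation.\<close>

lemma unit_integral_kernel0:
  assumes "degree w \<le> N" shows "unit_integral (kernel0 N * w) = poly w 0"
proof -
  have "poly ((pderiv ^^ N) (bernstein N (Suc N))) 0 = fact N"
    using bernstein_at_0[of N 0 "Suc N"] by simp
  then show ?thesis
    using unit_integral_bernstein[OF assms, of N "Suc N"]
    by (simp add: kernel0_def unit_integral_smult unit_integral_uminus bernstein_at_1 bernstein_at_0_less del: funpow.simps)
qed

lemma unit_integral_kernel1:
  assumes "degree w \<le> N" shows "unit_integral (kernel1 N * w) = poly w 1"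
proof -
  have "poly ((pderiv ^^ N) (bernstein N (Suc N))) 0 = fact N"
    using bernstein_at_0[of N 0 "Suc N"] by simp
  then show ?thesis
    using unit_integral_bernstein[OF assms, of "Suc N" N]
    by (simp add: kernel1_def unit_integral_smult bernstein_at_1 bernstein_at_0_less del: funpow.simps)
qed

lemma poly_higher_pderiv_kernel0:
  "poly ((pderiv ^^ k) (kernel0 N)) 0
     = (-1) ^ k * fact (N + 1 + k) / fact N * of_nat (Suc N choose Suc k)"
  "poly ((pderiv ^^ k) (kernel0 N)) 1
     = (-1) ^ N * fact (N + 1 + k) / fact N * of_nat (N choose k)"
proof -
  \<comment> \<open>The order \<open>k + Suc N\<close> is split in two ways, since
    \<open>bernstein_at_0\<close> measures the excess over the order of the zero:
    \<open>Suc k\<close> where that order is \<open>N\<close>, and \<open>k\<close> where it is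
    \<open>Suc N\<close>.\<close>
  have e: "(pderiv ^^ k) ((pderiv ^^ Suc N) p) = (pderiv ^^ (N + Suc k)) p"
    "(pderiv ^^ k) ((pderiv ^^ Suc N) p) = (pderiv ^^ (Suc N + k)) p" for p :: "complex poly"
    using funpow_add[of k "Suc N" "pderiv :: complex poly \<Rightarrow> _"]
    by (simp_all add: ac_simps fun_eq_iff del: funpow.simps)
  show "poly ((pderiv ^^ k) (kernel0 N)) 0
     = (-1) ^ k * fact (N + 1 + k) / fact N * of_nat (Suc N choose Suc k)"
    unfolding kernel0_def higher_pderiv_smult e(1) poly_smult bernstein_at_0 by simp
  show "poly ((pderiv ^^ k) (kernel0 N)) 1
     = (-1) ^ N * fact (N + 1 + k) / fact N * of_nat (N choose k)"
    unfolding kernel0_def higher_pderiv_smult e(2) poly_smult bernstein_at_1 bernstein_at_0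
    by (simp add: power_add flip: power_mult_distrib)
qed

lemma poly_higher_pderiv_kernel1:
  "poly ((pderiv ^^ k) (kernel1 N)) 0
     = (-1) ^ (N + k) * fact (N + 1 + k) / fact N * of_nat (N choose k)"
  "poly ((pderiv ^^ k) (kernel1 N)) 1
     = fact (N + 1 + k) / fact N * of_nat (Suc N choose Suc k)"
proof -
  have e: "(pderiv ^^ k) ((pderiv ^^ Suc N) p) = (pderiv ^^ (N + Suc k)) p"
    "(pderiv ^^ k) ((pderiv ^^ Suc N) p) = (pderiv ^^ (Suc N + k)) p" for p :: "complex poly"
    using funpow_add[of k "Suc N" "pderiv :: complex poly \<Rightarrow> _"]
    by (simp_all add: ac_simps fun_eq_iff del: funpow.simps)
  show "poly ((pderiv ^^ k) (kernel1 N)) 0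
     = (-1) ^ (N + k) * fact (N + 1 + k) / fact N * of_nat (N choose k)"
    unfolding kernel1_def higher_pderiv_smult e(2) poly_smult bernstein_at_0 by (simp add: power_add)
  show "poly ((pderiv ^^ k) (kernel1 N)) 1
     = fact (N + 1 + k) / fact N * of_nat (Suc N choose Suc k)"
    unfolding kernel1_def higher_pderiv_smult e(1) poly_smult bernstein_at_1 bernstein_at_0
    by (simp add: power_add flip: power_mult_distrib)
qed

text \<open>\<open>R\<close> and \<open>L\<close> stand for the numerical fluxes at the right and left end of the cell; \<open>a\<close> and \<open>b\<close>
  below are the defects \<open>R - P(1)\<close> and \<open>P(0) - L\<close>.\<close>

definition weak_form :: "complex \<Rightarrow> complex poly \<Rightarrow> complex \<Rightarrow> complex \<Rightarrow> complex poly \<Rightarrow> complex" where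
  "weak_form z P R L w = - z * unit_integral (P * w) - unit_integral (P * pderiv w) + R * poly w 1 - L * poly w 0"

definition cell_eq :: "nat \<Rightarrow> complex \<Rightarrow> complex poly \<Rightarrow> complex \<Rightarrow> complex \<Rightarrow> bool" where
  "cell_eq N z P a b \<longleftrightarrow> pderiv P - smult z P + smult a (kernel1 N) + smult b (kernel0 N) = 0"

text \<open>Integration by parts and the kernels turn the weak form into the integral of a residual
  against \<open>w\<close>. The residual has degree at most \<open>N\<close>, so orthogonality to
  all test polynomials makes it zero.\<close>

lemma weak_iff_cell_eq:
  assumes P: "degree P \<le> N"
  shows "(\<forall>w. degree w \<le> N \<longrightarrow> weak_form z P R L w = 0)
    \<longleftrightarrow> cell_eq N z P (R - poly P 1) (poly P 0 - L)"
proof -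
  let ?q = "pderiv P - smult z P + smult (R - poly P 1) (kernel1 N) + smult (poly P 0 - L) (kernel0 N)"
  have eq: "unit_integral (?q * w) = weak_form z P R L w"
    if "degree w \<le> N" for w
  proof -
    have "unit_integral (?q * w) = unit_integral (pderiv P * w) - z * unit_integral (P * w)
        + (R - poly P 1) * unit_integral (kernel1 N * w) + (poly P 0 - L) * unit_integral (kernel0 N * w)"
      by (simp only: distrib_right left_diff_distrib mult_smult_left unit_integral_add unit_integral_diff unit_integral_smult)
    then show ?thesis
      unfolding weak_form_def unit_integral_parts unit_integral_kernel0[OF that] unit_integral_kernel1[OF that]
      by (simp add: algebra_simps)
  qed
  have "degree (pderiv P) \<le> N"
    using P by (simp add: degree_pderiv)
  then have "degree ?q \<le> N"
    using P degree_kernel0[of N] degree_kernel1[of N]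
    by (intro degree_add_le degree_diff_le order_trans[OF degree_smult_le]) auto
  then have "(\<forall>w. degree w \<le> N \<longrightarrow> unit_integral (?q * w) = 0) \<longleftrightarrow> ?q = 0"
    using unit_integral_orthogonal_imp_zero[of ?q N] by auto
  then show ?thesis
    unfolding cell_eq_def by (simp add: eq)
qed

subsection \<open>Solving the cell equation; Pade approximants\<close>

text \<open>The truncated Neumann series inverting \<open>z - d/dx\<close> on polynomials of degree at most N.\<close>

definition resolvent :: "nat \<Rightarrow> complex \<Rightarrow> complex poly \<Rightarrow> complex poly" where
  "resolvent N z q = (\<Sum>k\<le>N. smult (1 / z ^ Suc k) ((pderiv ^^ k) q))"

lemma degree_resolvent: "degree q \<le> N \<Longrightarrow> degree (resolvent N z q) \<le> N"
  unfolding resolvent_def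
  by (intro degree_sum_le) (auto intro!: order_trans[OF degree_smult_le] simp: degree_higher_pderiv)

lemma resolvent_smult: "resolvent N z (smult c q) = smult c (resolvent N z q)"
  by (rule poly_eqI) (simp add: resolvent_def higher_pderiv_smult coeff_sum sum_distrib_left mult_ac)

lemma resolvent_add: "resolvent N z (p + q) = resolvent N z p + resolvent N z q"
  by (simp add: resolvent_def higher_pderiv_add smult_add_right sum.distrib)

lemma resolvent_uminus: "resolvent N z (- p) = - resolvent N z p"
  using resolvent_smult[of N z "-1" p] by simp

lemma resolvent_diff: "resolvent N z (p - q) = resolvent N z p - resolvent N z q"
  using resolvent_add[of N z p "- q"] by (simp add: resolvent_uminus)

text \<open>Commutation with d/dx makes the right inverse also a left inverse, which gives
  uniqueness below.\<close>

lemma resolvent_pderiv: "resolvent N z (pderiv q) = pderiv (resolvent N z q)"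
  unfolding resolvent_def using higher_pderiv_sum[of 1 "\<lambda>k. smult (1 / z ^ Suc k) ((pderiv ^^ k) q)" "{..N}"] by (simp add: pderiv_smult funpow_swap1)

text \<open>The sum telescopes to a remainder of order \<open>Suc N\<close>, which disappears on
  polynomials of degree at most \<open>N\<close>.\<close>

lemma pderiv_resolvent:
  assumes "z \<noteq> 0"
  shows "pderiv (resolvent N z q) - smult z (resolvent N z q) = smult (1 / z ^ Suc N) ((pderiv ^^ Suc N) q) - q"
proof (induction N)
  case 0
  then show ?case using assms by (simp add: resolvent_def pderiv_smult)
next
  case (Suc N)
  have "resolvent (Suc N) z q = resolvent N z q + smult (1 / z ^ Suc (Suc N)) ((pderiv ^^ Suc N) q)"
    by (simp add: resolvent_def)
  then have "pderiv (resolvent (Suc N) z q) - smult z (resolvent (Suc N) z q)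
      = (pderiv (resolvent N z q) - smult z (resolvent N z q))
        + smult (1 / z ^ Suc (Suc N)) ((pderiv ^^ Suc (Suc N)) q)
        - smult (1 / z ^ Suc N) ((pderiv ^^ Suc N) q)"
    using assms by (simp add: pderiv_add pderiv_smult smult_add_right algebra_simps)
  then show ?case by (simp only: Suc.IH) simp
qed

lemma cell_eq_iff_resolvent:
  assumes z: "z \<noteq> 0" and P: "degree P \<le> N"
  shows "cell_eq N z P a b \<longleftrightarrow> P = resolvent N z (smult a (kernel1 N) + smult b (kernel0 N))"
    (is "_ \<longleftrightarrow> P = resolvent N z ?q")
proof -
  have top: "(pderiv ^^ Suc N) p = 0" if "degree p \<le> N" for p :: "complex poly"
    using that by (simp add: pderiv_eq_0_iff degree_higher_pderiv)
  have q: "degree ?q \<le> N"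
    by (intro degree_add_le order_trans[OF degree_smult_le] degree_kernel0 degree_kernel1)
  have res: "pderiv (resolvent N z p) - smult z (resolvent N z p) = - p" if "degree p \<le> N" for p
    using pderiv_resolvent[OF z, of N p] top[OF that] by simp
  show ?thesis
  proof
    assume "cell_eq N z P a b"
    then have "pderiv P - smult z P = - ?q"
      unfolding cell_eq_def by (metis add.assoc eq_neg_iff_add_eq_0)
    \<comment> \<open>Apply the resolvent to the equation and commute it with d/dx; the left side
      becomes \<open>- P\<close>.\<close>
    then have "resolvent N z (pderiv P - smult z P) = - resolvent N z ?q"
      by (simp only: resolvent_uminus)
    then show "P = resolvent N z ?q"
      using res[OF P] by (simp only: resolvent_diff resolvent_pderiv resolvent_smult) simp
  next
    assume "P = resolvent N z ?q"
    then have "pderiv P - smult z P = - ?q"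
      using res[OF q] by simp
    then show "cell_eq N z P a b"
      unfolding cell_eq_def by (simp add: add.assoc)
  qed
qed

text \<open>For \<open>n \<le> 2 * N + 1\<close> this is the numerator, with constant term 1, of the
  Pade approximant of \<open>exp\<close> with numerator degree \<open>n\<close> and denominator
  degree \<open>2 * N + 1 - n\<close>.\<close>

definition pade :: "nat \<Rightarrow> nat \<Rightarrow> complex \<Rightarrow> complex" where
  "pade N n z = (\<Sum>m\<le>n. of_nat (n choose m) * fact (2 * N + 1 - m) / fact (2 * N + 1) * z ^ m)"

text \<open>Up to sign this is the last term, \<open>k = N\<close>, of the resolvent sums; factoring
  it out leaves polynomials with constant term 1.\<close>

definition kap :: "nat \<Rightarrow> complex \<Rightarrow> complex" where
  "kap N z = fact (2 * N + 1) / (fact N * z ^ Suc N)"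

text \<open>Both Pochhammer symbols are factorials times binomials with the same sign. For
  \<open>m > n\<close> the numerator vanishes and the series stops; for \<open>m \<le> n\<close> the
  bound on \<open>n\<close> keeps the denominator nonzero.\<close>

lemma hyp1F1_eq_pade:
  assumes "n \<le> 2 * N + 1"
  shows "hyp1F1 (- of_nat n) (- 2 * of_nat N - 1) z = pade N n z"
proof -
  have ph: "pochhammer (- of_nat k :: complex) m = (-1) ^ m * fact m * of_nat (k choose m)" for k m :: nat
    using gbinomial_pochhammer[of "of_nat k :: complex" m]
    by (cases "even m") (simp_all add: binomial_gbinomial field_simps)
  have b: "(- 2 * of_nat N - 1 :: complex) = - of_nat (2 * N + 1)"
    by simp
  have "hyp1F1 (- of_nat n) (- 2 * of_nat N - 1) z
      = (\<Sum>m\<le>n. pochhammer (- of_nat n) m / pochhammer (- 2 * of_nat N - 1) m * (z ^ m / fact m))"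
    unfolding hyp1F1_def
    by (rule suminf_finite) (auto simp: ph not_le)
  also have "\<dots> = pade N n z"
    unfolding pade_def b ph
  proof (rule sum.cong[OF refl])
    fix m assume "m \<in> {..n}"
    then have m: "m \<le> 2 * N + 1" using assms by simp
    show "(-1) ^ m * fact m * of_nat (n choose m) / ((-1) ^ m * fact m * of_nat (2 * N + 1 choose m)) * (z ^ m / fact m)
        = of_nat (n choose m) * fact (2 * N + 1 - m) / fact (2 * N + 1) * z ^ m"
      using m by (subst binomial_fact[OF m]) (simp add: field_simps del: fact_Suc)
  qed
  finally show ?thesis .
qed

lemma Fp_eq: "Fp N W = pade N N (\<i> * of_real W)" and Fm_eq: "Fm N W = pade N N (- (\<i> * of_real W))"
  unfolding Fp_def Fm_def using hyp1F1_eq_pade[of N N] by simp_all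

lemma Gp_eq: "Gp N W = pade N (Suc N) (\<i> * of_real W)"
  and Gm_eq: "Gm N W = pade N (Suc N) (- (\<i> * of_real W))"
proof -
  have "(- of_nat N - 1 :: complex) = - of_nat (Suc N)"
    by simp
  then show "Gp N W = pade N (Suc N) (\<i> * of_real W)" "Gm N W = pade N (Suc N) (- (\<i> * of_real W))"
    unfolding Gp_def Gm_def using hyp1F1_eq_pade[of "Suc N" N] by (simp_all only: mult_minus_left)
qed

lemma pade_0: "pade N n 0 = 1"
  by (simp add: pade_def power_0_left if_distrib[of "\<lambda>x. _ * x"] sum.delta cong: if_cong del: fact_Suc)

lemma cnj_pade: "cnj (pade N n z) = pade N n (cnj z)"
  by (simp add: pade_def)

text \<open>Read backwards, with \<open>k = N - m\<close>, the polynomial becomes a sum over inverse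
  powers of \<open>z\<close>, the form in which the resolvent produces it.\<close>

lemma kap_pade_N:
  assumes "z \<noteq> 0"
  shows "kap N z * pade N N z
    = (\<Sum>k\<le>N. 1 / z ^ Suc k * (fact (N + 1 + k) / fact N * of_nat (N choose k)))"
proof -
  have "kap N z * pade N N z
      = (\<Sum>m\<le>N. 1 / z ^ Suc (N - m) * (fact (N + 1 + (N - m)) / fact N * of_nat (N choose m)))"
    unfolding pade_def kap_def sum_distrib_left
  proof (rule sum.cong[OF refl])
    fix m assume "m \<in> {..N}"
    then obtain k where N: "N = m + k" using le_Suc_ex by auto
    show "fact (2 * N + 1) / (fact N * z ^ Suc N)
        * (of_nat (N choose m) * fact (2 * N + 1 - m) / fact (2 * N + 1) * z ^ m)
      = 1 / z ^ Suc (N - m) * (fact (N + 1 + (N - m)) / fact N * of_nat (N choose m))"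
    proof -
      have e: "2 * N + 1 - m = N + 1 + (N - m)" using N by simp
      have "z ^ Suc N = z ^ Suc (N - m) * z ^ m" using N by (simp add: power_add)
      then show ?thesis unfolding e using assms by (simp add: mult_ac del: fact_Suc power_Suc)
    qed
  qed
  also have "\<dots> = (\<Sum>k\<le>N. 1 / z ^ Suc k * (fact (N + 1 + k) / fact N * of_nat (N choose k)))"
    by (rule sum.reindex_bij_witness[of _ "\<lambda>k. N - k" "\<lambda>k. N - k"])
      (auto simp: binomial_symmetric[symmetric])
  finally show ?thesis .
qed

text \<open>The top term \<open>m = Suc N\<close> has no counterpart in the resolvent sum and
  contributes exactly 1; this constant accounts for the difference between trace and numerical flux
  in \<open>cell_eq_traces\<close>.\<close>

lemma kap_pade_Suc:
  assumes "z \<noteq> 0"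
  shows "kap N z * pade N (Suc N) z
    = (\<Sum>k\<le>N. 1 / z ^ Suc k * (fact (N + 1 + k) / fact N * of_nat (Suc N choose Suc k))) + 1"
proof -
  have "kap N z * pade N (Suc N) z
      = (\<Sum>m\<le>N. 1 / z ^ Suc (N - m) * (fact (N + 1 + (N - m)) / fact N * of_nat (Suc N choose m))) + 1"
    unfolding pade_def kap_def distrib_left sum_distrib_left sum.atMost_Suc
  proof (rule arg_cong2[where f = "(+)", OF sum.cong[OF refl]])
    fix m assume "m \<in> {..N}"
    then obtain k where N: "N = m + k" using le_Suc_ex by auto
    show "fact (2 * N + 1) / (fact N * z ^ Suc N)
        * (of_nat (Suc N choose m) * fact (2 * N + 1 - m) / fact (2 * N + 1) * z ^ m)
      = 1 / z ^ Suc (N - m) * (fact (N + 1 + (N - m)) / fact N * of_nat (Suc N choose m))"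
    proof -
      have e: "2 * N + 1 - m = N + 1 + (N - m)" using N by simp
      have "z ^ Suc N = z ^ Suc (N - m) * z ^ m" using N by (simp add: power_add)
      then show ?thesis unfolding e using assms by (simp add: mult_ac del: fact_Suc power_Suc)
    qed
  next
    have "2 * N + 1 - Suc N = N" by simp
    then show "fact (2 * N + 1) / (fact N * z ^ Suc N)
        * (of_nat (Suc N choose Suc N) * fact (2 * N + 1 - Suc N) / fact (2 * N + 1) * z ^ Suc N) = 1"
      using assms by (simp del: fact_Suc)
  qed
  also have "(\<Sum>m\<le>N. 1 / z ^ Suc (N - m) * (fact (N + 1 + (N - m)) / fact N * of_nat (Suc N choose m)))
    = (\<Sum>k\<le>N. 1 / z ^ Suc k * (fact (N + 1 + k) / fact N * of_nat (Suc N choose Suc k)))"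
    by (rule sum.reindex_bij_witness[of _ "\<lambda>k. N - k" "\<lambda>k. N - k"])
      (auto simp: binomial_symmetric[of "Suc _" "Suc N"] binomial_symmetric[of _ "Suc N"] Suc_diff_le)
  finally show ?thesis .
qed

lemma kap_uminus: "kap N (- z) = - ((-1) ^ N) * kap N z"
  by (cases "even N") (simp_all add: kap_def power_minus_odd)

lemma poly_resolvent: "poly (resolvent N z q) x = (\<Sum>k\<le>N. 1 / z ^ Suc k * poly ((pderiv ^^ k) q) x)"
  by (simp add: resolvent_def poly_sum)

text \<open>At 1 the signs of the kernel derivatives do not depend on \<open>k\<close>; at 0 they
  alternate, which is absorbed by replacing \<open>z\<close> by \<open>- z\<close>.\<close>

lemma resolvent_K_traces:
  assumes z: "z \<noteq> 0"
  shows "poly (resolvent N z (kernel0 N)) 0 = (-1) ^ N * kap N z * pade N (Suc N) (- z) + 1"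
    and "poly (resolvent N z (kernel0 N)) 1 = (-1) ^ N * kap N z * pade N N z"
    and "poly (resolvent N z (kernel1 N)) 0 = kap N z * pade N N (- z)"
    and "poly (resolvent N z (kernel1 N)) 1 = kap N z * pade N (Suc N) z - 1"
proof -
  have kap: "(-1) ^ N * kap N z = - kap N (- z)" "kap N z = - ((-1) ^ N * kap N (- z))"
    using kap_uminus[of N z] by (simp_all flip: power_mult_distrib mult.assoc)
  have mz: "- z \<noteq> 0" using z by simp
  have pm: "(- z) ^ Suc k = - ((-1) ^ k) * z ^ Suc k" for k
    by (cases "even k") (simp_all add: power_minus_odd)
  have sg: "x / ((-1) ^ k * y) = (-1) ^ k * x / y" "x / (w * (y * (-1) ^ k)) = (-1) ^ k * x / (w * y)"
    for w x y :: complex and k :: nat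
    by (cases "even k"; simp)+
  show "poly (resolvent N z (kernel0 N)) 0 = (-1) ^ N * kap N z * pade N (Suc N) (- z) + 1"
    unfolding kap(1) mult_minus_left kap_pade_Suc[OF mz] poly_resolvent poly_higher_pderiv_kernel0
    by (simp add: sum_negf[symmetric] pm sg mult.assoc del: power_Suc fact_Suc binomial_Suc_Suc)
  show "poly (resolvent N z (kernel0 N)) 1 = (-1) ^ N * kap N z * pade N N z"
    unfolding mult.assoc kap_pade_N[OF z] poly_resolvent poly_higher_pderiv_kernel0
    by (simp add: sum_distrib_left mult_ac del: power_Suc fact_Suc)
  show "poly (resolvent N z (kernel1 N)) 0 = kap N z * pade N N (- z)"
    unfolding kap(2) mult_minus_left mult.assoc kap_pade_N[OF mz] poly_resolvent poly_higher_pderiv_kernel1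
    by (simp add: sum_distrib_left sum_negf[symmetric] pm sg power_add mult_ac del: power_Suc fact_Suc)
  show "poly (resolvent N z (kernel1 N)) 1 = kap N z * pade N (Suc N) z - 1"
    unfolding kap_pade_Suc[OF z] poly_resolvent poly_higher_pderiv_kernel1 by simp
qed

text \<open>The left sides are the numerical fluxes at the two ends; passing from traces to fluxes
  cancels the constants 1 of \<open>resolvent_K_traces\<close>.\<close>

lemma cell_eq_traces:
  assumes "z \<noteq> 0" "degree P \<le> N" "cell_eq N z P a b"
  shows "poly P 0 - b = kap N z * ((-1) ^ N * b * pade N (Suc N) (- z) + a * pade N N (- z))"
    and "poly P 1 + a = kap N z * ((-1) ^ N * b * pade N N z + a * pade N (Suc N) z)"
proof -
  have P: "P = smult a (resolvent N z (kernel1 N)) + smult b (resolvent N z (kernel0 N))"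
    using assms by (simp add: cell_eq_iff_resolvent resolvent_add resolvent_smult)
  show "poly P 0 - b = kap N z * ((-1) ^ N * b * pade N (Suc N) (- z) + a * pade N N (- z))"
    "poly P 1 + a = kap N z * ((-1) ^ N * b * pade N N z + a * pade N (Suc N) z)"
    unfolding P poly_add poly_smult resolvent_K_traces[OF assms(1)] by (simp_all add: algebra_simps)
qed

subsection \<open>Bloch modes on the reference cell\<close>

text \<open>\<open>bloch_flux\<close> is the flux at the right end of the cell; by the Bloch condition the one at the left
  end is \<open>bloch_flux / l\<close>. The equation for \<open>Q\<close> is the one for \<open>P\<close> with \<open>z\<close> replaced by \<open>- z\<close>.\<close>

definition bloch_flux :: "complex \<Rightarrow> complex \<Rightarrow> complex poly \<Rightarrow> complex poly \<Rightarrow> complex" where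
  "bloch_flux \<alpha> l P Q = (l * poly P 0 + poly P 1) / 2 + \<alpha> / 2 * (l * poly Q 0 - poly Q 1)"

definition bloch_eq :: "nat \<Rightarrow> complex \<Rightarrow> complex \<Rightarrow> complex \<Rightarrow> complex poly \<Rightarrow> complex poly \<Rightarrow> bool" where
  "bloch_eq N \<alpha> l z P Q \<longleftrightarrow>
     cell_eq N z P (bloch_flux \<alpha> l P Q - poly P 1) (poly P 0 - bloch_flux \<alpha> l P Q / l)"

definition bloch_mode :: "nat \<Rightarrow> complex \<Rightarrow> complex \<Rightarrow> complex \<Rightarrow> complex poly \<Rightarrow> complex poly \<Rightarrow> bool" where
  "bloch_mode N \<alpha> l z P Q \<longleftrightarrow> degree P \<le> N \<and> degree Q \<le> N \<and>
     bloch_eq N \<alpha> l z P Q \<and> bloch_eq N \<alpha> l (- z) Q P"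

text \<open>In terms of the defects, \<open>a + l * b\<close> is the jump
  \<open>l * p0 - p1\<close>, and \<open>a - l * b\<close> is twice the difference of flux and mean.
  This separates the Bloch condition, right flux equal to \<open>l\<close> times left flux, from the
  definition of the fluxes.\<close>

lemma flux_conditions:
  fixes l \<alpha> p0 p1 q0 q1 a b c d :: complex
  assumes l: "l \<noteq> 0"
  defines "r \<equiv> (l * p0 + p1) / 2 + \<alpha> / 2 * (l * q0 - q1)"
    and "s \<equiv> (l * q0 + q1) / 2 + \<alpha> / 2 * (l * p0 - p1)"
  shows "(a = r - p1 \<and> b = p0 - r / l \<and> c = s - q1 \<and> d = q0 - s / l) \<longleftrightarrow>
    (p1 + a = l * (p0 - b) \<and> q1 + c = l * (q0 - d) \<and>
     a - l * b = \<alpha> * (c + l * d) \<and> c - l * d = \<alpha> * (a + l * b))" (is "?A \<longleftrightarrow> ?B")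
proof
  assume A: ?A
  have lb: "l * b = l * p0 - r" "l * d = l * q0 - s"
    using A l by (simp_all add: right_diff_distrib)
  have ac: "a = r - p1" "c = s - q1"
    using A by blast+
  have ab: "l * p0 - p1 = a + l * b" "l * q0 - q1 = c + l * d"
    unfolding lb ac by (simp_all add: algebra_simps)
  have rs: "2 * r - p1 - l * p0 = \<alpha> * (l * q0 - q1)" "2 * s - q1 - l * q0 = \<alpha> * (l * p0 - p1)"
    unfolding r_def s_def by (simp_all add: field_simps)
  have "a - l * b = 2 * r - p1 - l * p0" "c - l * d = 2 * s - q1 - l * q0"
    unfolding lb ac by (simp_all add: algebra_simps)
  moreover have "p1 + a = l * (p0 - b)" "q1 + c = l * (q0 - d)"
    unfolding right_diff_distrib lb ac by simp_all
  ultimately show ?B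
    unfolding rs ab by blast
next
  assume ?B
  then have B: "p1 + a = l * (p0 - b)" "q1 + c = l * (q0 - d)"
    "\<alpha> * (c + l * d) = a - l * b" "\<alpha> * (a + l * b) = c - l * d"
    by simp_all
  have p: "p1 = l * (p0 - b) - a" "q1 = l * (q0 - d) - c"
    unfolding B(1,2)[symmetric] by simp_all
  have e: "l * p0 - p1 = a + l * b" "l * q0 - q1 = c + l * d"
    unfolding p by (simp_all add: algebra_simps)
  have "2 * r = l * p0 + p1 + \<alpha> * (l * q0 - q1)" "2 * s = l * q0 + q1 + \<alpha> * (l * p0 - p1)"
    unfolding r_def s_def by (simp_all add: field_simps)
  then have "2 * r = 2 * (l * (p0 - b))" "2 * s = 2 * (l * (q0 - d))"
    unfolding e B(3,4) unfolding p by (simp_all add: algebra_simps)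
  then have r: "r = l * (p0 - b)" "s = l * (q0 - d)"
    by simp_all
  have "r / l = p0 - b" "s / l = q0 - d"
    unfolding r using l by simp_all
  moreover have "a = r - p1" "c = s - q1"
    unfolding r B(1,2)[symmetric] by simp_all
  ultimately show ?A by simp
qed

text \<open>Treating the defects as unknowns decouples the two cell equations; the four remaining
  relations become the rows of the Bloch matrix.\<close>

lemma bloch_mode_iff:
  assumes l: "l \<noteq> 0"
  shows "bloch_mode N \<alpha> l z P Q \<longleftrightarrow> degree P \<le> N \<and> degree Q \<le> N \<and>
      (\<exists>a b c d. cell_eq N z P a b \<and> cell_eq N (- z) Q c d \<and>
        poly P 1 + a = l * (poly P 0 - b) \<and> poly Q 1 + c = l * (poly Q 0 - d) \<and>
        a - l * b = \<alpha> * (c + l * d) \<and> c - l * d = \<alpha> * (a + l * b))"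
  unfolding bloch_mode_def bloch_eq_def bloch_flux_def flux_conditions[OF l, symmetric] by auto

section \<open>The determinant and the kernel of the Bloch matrix\<close>

lemma vector_4:
  "(vector [x, y, z, w] :: ('a::zero)^4) $ 1 = x"
  "(vector [x, y, z, w] :: ('a::zero)^4) $ 2 = y"
  "(vector [x, y, z, w] :: ('a::zero)^4) $ 3 = z"
  "(vector [x, y, z, w] :: ('a::zero)^4) $ 4 = w"
  unfolding vector_def by simp_all

lemma det_4:
  "det (A :: 'a::comm_ring_1^4^4) =
     A$1$1 * (A$2$2 * (A$3$3 * A$4$4 - A$3$4 * A$4$3) - A$2$3 * (A$3$2 * A$4$4 - A$3$4 * A$4$2)
       + A$2$4 * (A$3$2 * A$4$3 - A$3$3 * A$4$2))
   - A$1$2 * (A$2$1 * (A$3$3 * A$4$4 - A$3$4 * A$4$3) - A$2$3 * (A$3$1 * A$4$4 - A$3$4 * A$4$1)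
       + A$2$4 * (A$3$1 * A$4$3 - A$3$3 * A$4$1))
   + A$1$3 * (A$2$1 * (A$3$2 * A$4$4 - A$3$4 * A$4$2) - A$2$2 * (A$3$1 * A$4$4 - A$3$4 * A$4$1)
       + A$2$4 * (A$3$1 * A$4$2 - A$3$2 * A$4$1))
   - A$1$4 * (A$2$1 * (A$3$2 * A$4$3 - A$3$3 * A$4$2) - A$2$2 * (A$3$1 * A$4$3 - A$3$3 * A$4$1)
       + A$2$3 * (A$3$1 * A$4$2 - A$3$2 * A$4$1))"
proof -
  have f: "finite {2::4, 3, 4}" "1 \<notin> {2::4, 3, 4}" "finite {3::4, 4}" "2 \<notin> {3::4, 4}"
    "finite {4::4}" "3 \<notin> {4::4}"
    by auto
  show ?thesis
    unfolding det_def UNIV_4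
    unfolding sum_over_permutations_insert[OF f(1,2)]
    unfolding sum_over_permutations_insert[OF f(3,4)]
    unfolding sum_over_permutations_insert[OF f(5,6)]
    unfolding permutes_sing
    by (simp add: sign_swap_id permutation_swap_id permutation_compose sign_compose sign_id
        swap_id_eq algebra_simps)
qed

lemma det_eq_0_iff_kernel: "det (A :: 'a::field^'n^'n) = 0 \<longleftrightarrow> (\<exists>x. x \<noteq> 0 \<and> A *v x = 0)"
  using invertible_det_nz[of A] invertible_left_inverse[of A] matrix_left_invertible_ker[of A] by auto

lemma symmetric_quadratic:
  fixes l a b c :: complex
  assumes "l \<noteq> 0"
  shows "l\<^sup>2 * (a * (l + 1 / l)\<^sup>2 + b * (l + 1 / l) + c)
    = a * (l\<^sup>2 + 1)\<^sup>2 + b * (l\<^sup>2 + 1) * l + c * l\<^sup>2"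
proof -
  have "l + 1 / l = (l\<^sup>2 + 1) / l"
    using assms by (simp add: field_simps power2_eq_square)
  then show ?thesis
    using assms by (simp add: field_simps power2_eq_square)
qed

lemma det_bloch_matrix:
  assumes "l \<noteq> 0"
  shows "1 / l\<^sup>2 * det (bloch_matrix N \<alpha> \<Omega> l)
    = coef_a N \<alpha> \<Omega> * (l + 1 / l)\<^sup>2 + coef_b N \<alpha> \<Omega> * (l + 1 / l) + coef_c N \<alpha> \<Omega>"
proof -
  define q where "q = (-1 :: complex) ^ N * (1 - (of_real \<alpha>)\<^sup>2)"
  define g where "g = (1 + (of_real \<alpha>)\<^sup>2 :: complex)"
  \<comment> \<open>The entries of the first two rows stay opaque while the determinant is
    expanded.\<close>
  define x1 x2 x3 x4 where x: "x1 = l * Gm N \<Omega> - Fp N \<Omega>" "x2 = l * Fm N \<Omega> - Gp N \<Omega>"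
    "x3 = l * Gp N \<Omega> - Fm N \<Omega>" "x4 = l * Fp N \<Omega> - Gm N \<Omega>"
  \<comment> \<open>The parity split lets the square of the sign reduce to 1.\<close>
  consider "(-1 :: complex) ^ N = 1" | "(-1 :: complex) ^ N = -1"
    by (cases "even N") auto
  then have "det (bloch_matrix N \<alpha> \<Omega> l)
     = q * (x1 * x3) + l * g * (x1 * x4 + x2 * x3) + l\<^sup>2 * q * (x2 * x4)"
    unfolding det_4 bloch_matrix_def vector_4 x[symmetric] q_def g_def
    by cases (simp_all add: algebra_simps power2_eq_square)
  also have "\<dots> = (q * Fm N \<Omega> * Fp N \<Omega>) * (l\<^sup>2 + 1)\<^sup>2
     + (- q * (Fm N \<Omega> * Gm N \<Omega> + Fp N \<Omega> * Gp N \<Omega>)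
        + g * (Fp N \<Omega> * Gm N \<Omega> + Fm N \<Omega> * Gp N \<Omega>)) * (l\<^sup>2 + 1) * l
     + (2 * q * (Gm N \<Omega> * Gp N \<Omega> - Fm N \<Omega> * Fp N \<Omega>)
        - g * ((Fm N \<Omega>)\<^sup>2 + (Fp N \<Omega>)\<^sup>2 + (Gm N \<Omega>)\<^sup>2 + (Gp N \<Omega>)\<^sup>2)) * l\<^sup>2"
    unfolding x by (simp add: algebra_simps power2_eq_square)
  also have "\<dots> = coef_a N \<alpha> \<Omega> * (l\<^sup>2 + 1)\<^sup>2 + coef_b N \<alpha> \<Omega> * (l\<^sup>2 + 1) * l + coef_c N \<alpha> \<Omega> * l\<^sup>2"
    unfolding coef_a_def coef_b_def coef_c_def q_def g_def by (simp only: mult.assoc mult_minus_left)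
  finally have "det (bloch_matrix N \<alpha> \<Omega> l)
     = coef_a N \<alpha> \<Omega> * (l\<^sup>2 + 1)\<^sup>2 + coef_b N \<alpha> \<Omega> * (l\<^sup>2 + 1) * l + coef_c N \<alpha> \<Omega> * l\<^sup>2" .
  then show ?thesis
    unfolding symmetric_quadratic[OF assms, symmetric] using assms by simp
qed

lemma det_bloch_matrix_eq_0_iff:
  "det (bloch_matrix N \<alpha> \<Omega> l) = 0 \<longleftrightarrow> (\<exists>x y z w. (x \<noteq> 0 \<or> y \<noteq> 0 \<or> z \<noteq> 0 \<or> w \<noteq> 0) \<and>
     (l * Gm N \<Omega> - Fp N \<Omega>) * x + (l * Fm N \<Omega> - Gp N \<Omega>) * y = 0 \<and>
     (l * Gp N \<Omega> - Fm N \<Omega>) * z + (l * Fp N \<Omega> - Gm N \<Omega>) * w = 0 \<and>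
     l * (-1) ^ N * x - y - of_real \<alpha> * l * z - of_real \<alpha> * (-1) ^ N * w = 0 \<and>
     of_real \<alpha> * l * (-1) ^ N * x + of_real \<alpha> * y - l * z + (-1) ^ N * w = 0)"
    (is "_ \<longleftrightarrow> (\<exists>x y z w. ?P x y z w)")
proof -
  have P: "(v \<noteq> 0 \<and> bloch_matrix N \<alpha> \<Omega> l *v v = 0) \<longleftrightarrow> ?P (v$1) (v$2) (v$3) (v$4)" for v :: "complex^4"
    by (simp add: vec_eq_iff forall_4 matrix_vector_mult_def sum_4 bloch_matrix_def vector_4)
  have "(\<exists>v::complex^4. ?P (v$1) (v$2) (v$3) (v$4)) \<longleftrightarrow> (\<exists>x y z w. ?P x y z w)"
  proof
    assume "\<exists>x y z w. ?P x y z w"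
    then obtain x y z w where "?P x y z w" by blast
    then have "?P (vector [x, y, z, w] $ (1::4)) (vector [x, y, z, w] $ (2::4))
      (vector [x, y, z, w] $ (3::4)) (vector [x, y, z, w] $ (4::4))"
      unfolding vector_4 .
    then show "\<exists>v::complex^4. ?P (v$1) (v$2) (v$3) (v$4)" by (rule exI)
  qed blast
  then show ?thesis
    unfolding det_eq_0_iff_kernel P .
qed

text \<open>Away from \<Omega> = 0 the resolvent makes a mode a function of its four defects, and
  non-trivial modes correspond to nonzero defects, which after scaling are the kernel vectors of the
  matrix.\<close>

lemma ex_bloch_mode_iff_det:
  assumes l: "l \<noteq> 0" and \<Omega>: "\<Omega> \<noteq> 0"
  shows "(\<exists>P Q. (P, Q) \<noteq> (0, 0) \<and> bloch_mode N (of_real \<alpha>) l (\<i> * of_real \<Omega>) P Q)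
    \<longleftrightarrow> det (bloch_matrix N \<alpha> \<Omega> l) = 0"
proof -
  define z where "z = \<i> * complex_of_real \<Omega>"
  define A where "A = complex_of_real \<alpha>"
  define e where "e = (-1 :: complex) ^ N"
  define k where "k = kap N z"
  have z: "z \<noteq> 0" "- z \<noteq> 0" using \<Omega> by (auto simp: z_def)
  have k: "k \<noteq> 0" using z by (simp add: k_def kap_def del: fact_Suc)
  \<comment> \<open>This sign, the parity of \<open>z ^ Suc N\<close>, enters the two kernel
    components belonging to \<open>Q\<close>.\<close>
  have k': "kap N (- z) = - e * k" by (simp add: k_def e_def kap_uminus)
  have e: "e * e = 1" by (simp add: e_def flip: power_mult_distrib)
  have e2: "e * (e * x) = x" for x using e by (simp flip: mult.assoc)
  have e0: "e \<noteq> 0" by (simp add: e_def)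
  note FG = Fp_eq[of N \<Omega>, folded z_def] Fm_eq[of N \<Omega>, folded z_def]
    Gp_eq[of N \<Omega>, folded z_def] Gm_eq[of N \<Omega>, folded z_def]
  have tP: "poly P 0 - b = k * (e * b * Gm N \<Omega> + a * Fm N \<Omega>)"
    "poly P 1 + a = k * (e * b * Fp N \<Omega> + a * Gp N \<Omega>)"
    if "degree P \<le> N" "cell_eq N z P a b" for P a b
    using cell_eq_traces[OF z(1) that] by (simp_all add: FG k_def e_def)
  have tQ: "poly Q 0 - d = - e * k * (e * d * Gp N \<Omega> + c * Fp N \<Omega>)"
    "poly Q 1 + c = - e * k * (e * d * Fm N \<Omega> + c * Gm N \<Omega>)"
    if "degree Q \<le> N" "cell_eq N (- z) Q c d" for Q c d
    using cell_eq_traces[OF z(2) that] unfolding k' by (simp_all add: FG e_def)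
  \<comment> \<open>The kernel vector of the matrix attached to the defects \<open>a, b, c, d\<close> is
    \<open>(k e b, k a, - k d, - e k c)\<close>.\<close>
  have rows: "p1 + a = l * (p0 - b) \<and> q1 + c = l * (q0 - d) \<and>
      a - l * b = A * (c + l * d) \<and> c - l * d = A * (a + l * b) \<longleftrightarrow>
     (l * Gm N \<Omega> - Fp N \<Omega>) * (k * e * b) + (l * Fm N \<Omega> - Gp N \<Omega>) * (k * a) = 0 \<and>
     (l * Gp N \<Omega> - Fm N \<Omega>) * (- k * d) + (l * Fp N \<Omega> - Gm N \<Omega>) * (- e * k * c) = 0 \<and>
     l * e * (k * e * b) - k * a - A * l * (- k * d) - A * e * (- e * k * c) = 0 \<and>
     A * l * e * (k * e * b) + A * (k * a) - l * (- k * d) + e * (- e * k * c) = 0"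
    if "p0 - b = k * (e * b * Gm N \<Omega> + a * Fm N \<Omega>)"
      "p1 + a = k * (e * b * Fp N \<Omega> + a * Gp N \<Omega>)"
      "q0 - d = - e * k * (e * d * Gp N \<Omega> + c * Fp N \<Omega>)"
      "q1 + c = - e * k * (e * d * Fm N \<Omega> + c * Gm N \<Omega>)" for p0 p1 q0 q1 a b c d
  proof -
    \<comment> \<open>Up to the factor \<open>k\<close>, the last two rows are the flux relations;
      the first two state that the right flux is \<open>l\<close> times the left one.\<close>
    have "l * e * (k * e * b) - k * a - A * l * (- k * d) - A * e * (- e * k * c)
        = k * (A * (c + l * d) - (a - l * b))"
      "A * l * e * (k * e * b) + A * (k * a) - l * (- k * d) + e * (- e * k * c)
        = k * (A * (a + l * b) - (c - l * d))"
      using e by algebra+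
    moreover have "(l * Gm N \<Omega> - Fp N \<Omega>) * (k * e * b) + (l * Fm N \<Omega> - Gp N \<Omega>) * (k * a)
        = l * (p0 - b) - (p1 + a)"
      unfolding that by (simp add: algebra_simps)
    moreover have "(l * Gp N \<Omega> - Fm N \<Omega>) * (- k * d) + (l * Fp N \<Omega> - Gm N \<Omega>) * (- e * k * c)
        = l * (q0 - d) - (q1 + c)"
      unfolding that using e by algebra
    ultimately show ?thesis
      using k by (auto simp del: mult_minus_left)
  qed
  show ?thesis
    unfolding det_bloch_matrix_eq_0_iff z_def[symmetric] A_def[symmetric] e_def[symmetric]
  proof
    assume "\<exists>P Q. (P, Q) \<noteq> (0, 0) \<and> bloch_mode N A l z P Q"
    then obtain P Q a b c d where nz: "(P, Q) \<noteq> (0, 0)" and deg: "degree P \<le> N" "degree Q \<le> N"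
      and ce: "cell_eq N z P a b" "cell_eq N (- z) Q c d"
      and fl: "poly P 1 + a = l * (poly P 0 - b) \<and> poly Q 1 + c = l * (poly Q 0 - d) \<and>
        a - l * b = A * (c + l * d) \<and> c - l * d = A * (a + l * b)"
      unfolding bloch_mode_iff[OF l] by blast
    \<comment> \<open>Zero defects make both cell equations homogeneous, and for
      \<open>z \<noteq> 0\<close> their only solution is zero.\<close>
    have "k * e * b \<noteq> 0 \<or> k * a \<noteq> 0 \<or> - k * d \<noteq> 0 \<or> - e * k * c \<noteq> 0"
    proof (rule ccontr)
      assume "\<not> ?thesis"
      then have "a = 0" "b = 0" "c = 0" "d = 0" using k e0 by auto
      then have "P = 0" "Q = 0"
        using ce deg z by (auto simp: cell_eq_iff_resolvent resolvent_def)
      then show False using nz by simp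
    qed
    then show "\<exists>x y z w. (x \<noteq> 0 \<or> y \<noteq> 0 \<or> z \<noteq> 0 \<or> w \<noteq> 0) \<and>
       (l * Gm N \<Omega> - Fp N \<Omega>) * x + (l * Fm N \<Omega> - Gp N \<Omega>) * y = 0 \<and>
       (l * Gp N \<Omega> - Fm N \<Omega>) * z + (l * Fp N \<Omega> - Gm N \<Omega>) * w = 0 \<and>
       l * e * x - y - A * l * z - A * e * w = 0 \<and> A * l * e * x + A * y - l * z + e * w = 0"
      using fl unfolding rows[OF tP[OF deg(1) ce(1)] tQ[OF deg(2) ce(2)]] by blast
  next
    assume "\<exists>x y z w. (x \<noteq> 0 \<or> y \<noteq> 0 \<or> z \<noteq> 0 \<or> w \<noteq> 0) \<and>
       (l * Gm N \<Omega> - Fp N \<Omega>) * x + (l * Fm N \<Omega> - Gp N \<Omega>) * y = 0 \<and>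
       (l * Gp N \<Omega> - Fm N \<Omega>) * z + (l * Fp N \<Omega> - Gm N \<Omega>) * w = 0 \<and>
       l * e * x - y - A * l * z - A * e * w = 0 \<and> A * l * e * x + A * y - l * z + e * w = 0"
    then obtain X Y Z W where nz: "X \<noteq> 0 \<or> Y \<noteq> 0 \<or> Z \<noteq> 0 \<or> W \<noteq> 0" and
      eqs: "(l * Gm N \<Omega> - Fp N \<Omega>) * X + (l * Fm N \<Omega> - Gp N \<Omega>) * Y = 0"
       "(l * Gp N \<Omega> - Fm N \<Omega>) * Z + (l * Fp N \<Omega> - Gm N \<Omega>) * W = 0"
       "l * e * X - Y - A * l * Z - A * e * W = 0" "A * l * e * X + A * Y - l * Z + e * W = 0"
      by blast
    \<comment> \<open>The scaling is inverted, using that \<open>e\<close> is its own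
      inverse.\<close>
    define a b c d where abcd: "a = Y / k" "b = e * X / k" "c = - e * W / k" "d = - Z / k"
    have XY: "X = k * e * b" "Y = k * a" "Z = - k * d" "W = - e * k * c"
      using k by (simp_all add: abcd e2 mult.assoc)
    define P where "P = resolvent N z (smult a (kernel1 N) + smult b (kernel0 N))"
    define Q where "Q = resolvent N (- z) (smult c (kernel1 N) + smult d (kernel0 N))"
    have deg: "degree P \<le> N" "degree Q \<le> N"
      unfolding P_def Q_def
      by (intro degree_resolvent degree_add_le order_trans[OF degree_smult_le] degree_kernel0 degree_kernel1)+
    have ce: "cell_eq N z P a b" "cell_eq N (- z) Q c d"
      using deg z by (simp_all add: cell_eq_iff_resolvent P_def Q_def)
    have fl: "poly P 1 + a = l * (poly P 0 - b) \<and> poly Q 1 + c = l * (poly Q 0 - d) \<and>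
        a - l * b = A * (c + l * d) \<and> c - l * d = A * (a + l * b)"
      unfolding rows[OF tP[OF deg(1) ce(1)] tQ[OF deg(2) ce(2)]] using eqs unfolding XY by blast
    \<comment> \<open>Zero polynomials have zero traces and hence zero fluxes, so
      \<open>flux_conditions\<close> read backwards gives zero defects.\<close>
    have "(P, Q) \<noteq> (0, 0)"
    proof
      assume "(P, Q) = (0, 0)"
      then have "a = 0 \<and> b = 0 \<and> c = 0 \<and> d = 0"
        using fl[folded flux_conditions[OF l]] by simp
      then show False using nz XY by simp
    qed
    then show "\<exists>P Q. (P, Q) \<noteq> (0, 0) \<and> bloch_mode N A l z P Q"
      unfolding bloch_mode_iff[OF l] using deg ce fl by blast
  qed
qed

text \<open>At \<open>z = 0\<close> the operator \<open>z - d/dx\<close> is not invertible; the solutions are the constants and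
  the multiples of the shifted Legendre polynomial.\<close>

definition shifted_legendre :: "nat \<Rightarrow> complex poly" where
  "shifted_legendre N = smult ((-1) ^ N / fact N) ((pderiv ^^ N) (bernstein N N))"

lemma degree_shifted_legendre: "degree (shifted_legendre N) \<le> N"
  by (simp add: shifted_legendre_def degree_higher_pderiv degree_bernstein)

lemma poly_shifted_legendre: "poly (shifted_legendre N) 0 = (-1) ^ N" "poly (shifted_legendre N) 1 = 1"
  using bernstein_at_0[of N 0 N] by (simp_all add: shifted_legendre_def bernstein_at_1 flip: power_mult_distrib)

text \<open>The identity x + (1 - x) = 1 splits \<open>bernstein N N\<close> into the two
  polynomials behind the kernels.\<close>

lemma pderiv_shifted_legendre: "pderiv (shifted_legendre N) = kernel1 N - smult ((-1) ^ N) (kernel0 N)"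
proof -
  have "bernstein (Suc N) N + bernstein N (Suc N) = monom 1 N * ([:1, -1:] ^ N * ([:0, 1:] + [:1, -1:]))"
    by (simp add: bernstein_def monom_Suc algebra_simps)
  also have "\<dots> = bernstein N N"
    by (simp add: bernstein_def)
  finally have "bernstein N N = bernstein (Suc N) N + bernstein N (Suc N)" ..
  then show ?thesis
    unfolding shifted_legendre_def kernel0_def kernel1_def
    by (simp add: pderiv_smult higher_pderiv_add pderiv_add smult_add_right)
qed

text \<open>The ratio of the leading coefficients follows because the derivative of the Legendre
  polynomial has no term of degree \<open>N\<close>.\<close>

lemma coeff_K: "coeff (kernel0 N) N \<noteq> 0" "coeff (kernel1 N) N = (-1) ^ N * coeff (kernel0 N) N"
proof -
  have "unit_integral (kernel0 N * 1) = 1"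
    by (subst unit_integral_kernel0) simp_all
  then have "kernel0 N \<noteq> 0" by auto
  moreover have "degree (kernel0 N) = N"
    unfolding kernel0_def degree_smult_eq by (simp add: degree_higher_pderiv degree_bernstein del: funpow.simps)
  ultimately show "coeff (kernel0 N) N \<noteq> 0"
    by (metis leading_coeff_0_iff)
  have "coeff (pderiv (shifted_legendre N)) N = 0"
    using degree_shifted_legendre[of N] by (simp add: coeff_pderiv coeff_eq_0)
  then show "coeff (kernel1 N) N = (-1) ^ N * coeff (kernel0 N) N"
    by (simp add: pderiv_shifted_legendre)
qed

text \<open>Comparing coefficients of degree \<open>N\<close>, to which the derivative contributes
  nothing, forces the relation between \<open>a\<close> and \<open>b\<close>. A multiple of the
  Legendre polynomial is then a particular solution, and only a constant remains free.\<close>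

lemma cell_eq_0_iff:
  assumes "degree P \<le> N"
  shows "cell_eq N 0 P a b \<longleftrightarrow> b = - ((-1) ^ N) * a \<and> (\<exists>c. P = [:c:] - smult a (shifted_legendre N))"
proof
  assume ce: "cell_eq N 0 P a b"
  then have "coeff (pderiv P + smult a (kernel1 N) + smult b (kernel0 N)) N = 0"
    by (simp add: cell_eq_def)
  then have "(a * (-1) ^ N + b) * coeff (kernel0 N) N = 0"
    using assms by (simp add: coeff_pderiv coeff_eq_0 coeff_K algebra_simps)
  then have b: "b = - ((-1) ^ N) * a"
    using coeff_K(1)[of N] by (simp add: eq_neg_iff_add_eq_0 mult.commute add.commute)
  have "pderiv (P + smult a (shifted_legendre N)) = 0"
    using ce unfolding cell_eq_def b
    by (simp add: pderiv_add pderiv_smult pderiv_shifted_legendre smult_diff_right mult.commute add_diff_eq)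
  then obtain c where "P + smult a (shifted_legendre N) = [:c:]"
    by (auto simp: pderiv_eq_0_iff elim: degree_eq_zeroE)
  then show "b = - ((-1) ^ N) * a \<and> (\<exists>c. P = [:c:] - smult a (shifted_legendre N))"
    using b by (metis add_diff_cancel_right')
next
  assume "b = - ((-1) ^ N) * a \<and> (\<exists>c. P = [:c:] - smult a (shifted_legendre N))"
  then show "cell_eq N 0 P a b"
    by (auto simp: cell_eq_def pderiv_diff pderiv_smult pderiv_shifted_legendre pderiv_pCons smult_diff_right mult.commute)
qed

text \<open>Constants and Legendre parts decouple: a nonzero constant survives only for
  \<open>l = 1\<close>, and the Legendre coefficients satisfy a symmetric 2 by 2 system whose
  determinant is the difference of the two squares.\<close>

lemma ex_bloch_mode_0_iff:
  fixes N :: nat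
  assumes l: "l \<noteq> 0"
  defines "e \<equiv> (-1 :: complex) ^ N"
  shows "(\<exists>P Q. (P, Q) \<noteq> (0, 0) \<and> bloch_mode N \<alpha> l 0 P Q)
    \<longleftrightarrow> l = 1 \<or> (1 + l * e)\<^sup>2 = (\<alpha> * (1 - l * e))\<^sup>2"
proof -
  have mode: "bloch_mode N \<alpha> l 0 P Q \<longleftrightarrow> (\<exists>a c r s. P = [:r:] - smult a (shifted_legendre N) \<and> Q = [:s:] - smult c (shifted_legendre N)
      \<and> r = l * r \<and> s = l * s \<and> a * (1 + l * e) = \<alpha> * (1 - l * e) * c
      \<and> c * (1 + l * e) = \<alpha> * (1 - l * e) * a)" for P Q
  proof -
    have deg: "degree ([:r:] - smult a (shifted_legendre N)) \<le> N" for r a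
      by (intro degree_diff_le order_trans[OF degree_smult_le] degree_shifted_legendre) simp
    have fl: "(poly ([:r:] - smult a (shifted_legendre N)) 1 + a = l * (poly ([:r:] - smult a (shifted_legendre N)) 0 - - e * a)
        \<and> poly ([:s:] - smult c (shifted_legendre N)) 1 + c = l * (poly ([:s:] - smult c (shifted_legendre N)) 0 - - e * c)
        \<and> a - l * (- e * a) = \<alpha> * (c + l * (- e * c)) \<and> c - l * (- e * c) = \<alpha> * (a + l * (- e * a)))
      \<longleftrightarrow> (r = l * r \<and> s = l * s \<and> a * (1 + l * e) = \<alpha> * (1 - l * e) * c
        \<and> c * (1 + l * e) = \<alpha> * (1 - l * e) * a)" for r s a c
      by (simp add: poly_shifted_legendre e_def[symmetric] algebra_simps)
    show ?thesis
    proof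
      assume "bloch_mode N \<alpha> l 0 P Q"
      then obtain a b c d where "degree P \<le> N" "degree Q \<le> N" "cell_eq N 0 P a b" "cell_eq N 0 Q c d"
        and *: "poly P 1 + a = l * (poly P 0 - b) \<and> poly Q 1 + c = l * (poly Q 0 - d) \<and>
          a - l * b = \<alpha> * (c + l * d) \<and> c - l * d = \<alpha> * (a + l * b)"
        unfolding bloch_mode_iff[OF l] minus_zero by blast
      then obtain r s where "P = [:r:] - smult a (shifted_legendre N)" "Q = [:s:] - smult c (shifted_legendre N)"
        "b = - e * a" "d = - e * c"
        by (auto simp: cell_eq_0_iff e_def)
      then show "\<exists>a c r s. P = [:r:] - smult a (shifted_legendre N) \<and> Q = [:s:] - smult c (shifted_legendre N)
        \<and> r = l * r \<and> s = l * s \<and> a * (1 + l * e) = \<alpha> * (1 - l * e) * c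
        \<and> c * (1 + l * e) = \<alpha> * (1 - l * e) * a"
        using * fl[of r a s c] by blast
    next
      assume "\<exists>a c r s. P = [:r:] - smult a (shifted_legendre N) \<and> Q = [:s:] - smult c (shifted_legendre N)
        \<and> r = l * r \<and> s = l * s \<and> a * (1 + l * e) = \<alpha> * (1 - l * e) * c
        \<and> c * (1 + l * e) = \<alpha> * (1 - l * e) * a"
      then obtain a c r s where PQ: "P = [:r:] - smult a (shifted_legendre N)" "Q = [:s:] - smult c (shifted_legendre N)"
        and *: "r = l * r \<and> s = l * s \<and> a * (1 + l * e) = \<alpha> * (1 - l * e) * c
        \<and> c * (1 + l * e) = \<alpha> * (1 - l * e) * a"
        by blast
      have "degree P \<le> N" "degree Q \<le> N"
        unfolding PQ by (rule deg)+
      moreover from this have "cell_eq N 0 P a (- e * a)" "cell_eq N 0 Q c (- e * c)"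
        by (auto simp: cell_eq_0_iff e_def PQ)
      ultimately show "bloch_mode N \<alpha> l 0 P Q"
        unfolding bloch_mode_iff[OF l] minus_zero using *[folded fl] PQ by blast
    qed
  qed
  show ?thesis
  proof
    assume "\<exists>P Q. (P, Q) \<noteq> (0, 0) \<and> bloch_mode N \<alpha> l 0 P Q"
    then obtain a c r s where nz: "([:r:] - smult a (shifted_legendre N), [:s:] - smult c (shifted_legendre N)) \<noteq> (0, 0)"
      and rs: "r = l * r" "s = l * s" and ac: "a * (1 + l * e) = \<alpha> * (1 - l * e) * c"
      "c * (1 + l * e) = \<alpha> * (1 - l * e) * a"
      unfolding mode by blast
    show "l = 1 \<or> (1 + l * e)\<^sup>2 = (\<alpha> * (1 - l * e))\<^sup>2"
    proof (cases "l = 1")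
      case False
      then have "r = 0" "s = 0" using rs by auto
      then have "a \<noteq> 0 \<or> c \<noteq> 0" using nz by auto
      moreover have "a * ((1 + l * e)\<^sup>2 - (\<alpha> * (1 - l * e))\<^sup>2) = 0"
        "c * ((1 + l * e)\<^sup>2 - (\<alpha> * (1 - l * e))\<^sup>2) = 0"
        using ac by algebra+
      ultimately show ?thesis by auto
    qed simp
  next
    assume "l = 1 \<or> (1 + l * e)\<^sup>2 = (\<alpha> * (1 - l * e))\<^sup>2"
    then show "\<exists>P Q. (P, Q) \<noteq> (0, 0) \<and> bloch_mode N \<alpha> l 0 P Q"
    proof
      assume "l = 1"
      then have "bloch_mode N \<alpha> l 0 [:1:] 0"
        unfolding mode by (intro exI[of _ 0] exI[of _ "0::complex"] exI[of _ "1::complex"]) simp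
      then show ?thesis by (intro exI[of _ "[:1:]"] exI[of _ 0]) simp
    next
      assume "(1 + l * e)\<^sup>2 = (\<alpha> * (1 - l * e))\<^sup>2"
      \<comment> \<open>The sign \<sigma> relating the two square roots gives the null vector (1,
        \<sigma>) of the symmetric system.\<close>
      then obtain \<sigma> where \<sigma>: "\<sigma> * \<sigma> = 1" "1 + l * e = \<sigma> * (\<alpha> * (1 - l * e))"
        using that[of 1] that[of "-1"] by (auto simp: power2_eq_iff)
      have "bloch_mode N \<alpha> l 0 ([:0:] - smult 1 (shifted_legendre N)) ([:0:] - smult \<sigma> (shifted_legendre N))"
        unfolding mode
      proof (intro exI conjI)
        show "1 * (1 + l * e) = \<alpha> * (1 - l * e) * \<sigma>" "\<sigma> * (1 + l * e) = \<alpha> * (1 - l * e) * 1"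
          using \<sigma> by algebra+
      qed (rule refl | simp)+
      moreover have "shifted_legendre N \<noteq> 0" using poly_shifted_legendre(2)[of N] by auto
      ultimately show ?thesis
        by (intro exI[of _ "[:0:] - smult 1 (shifted_legendre N)"] exI[of _ "[:0:] - smult \<sigma> (shifted_legendre N)"]) simp
    qed
  qed
qed

section \<open>Both cases together, and reality of the coefficients\<close>

lemma ex_bloch_mode_iff:
  assumes l: "l \<noteq> 0"
  shows "(\<exists>P Q. (P, Q) \<noteq> (0, 0) \<and> bloch_mode N (of_real \<alpha>) l (\<i> * of_real \<Omega>) P Q)
    \<longleftrightarrow> coef_a N \<alpha> \<Omega> * (l + 1 / l)\<^sup>2 + coef_b N \<alpha> \<Omega> * (l + 1 / l) + coef_c N \<alpha> \<Omega> = 0"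
proof (cases "\<Omega> = 0")
  case False
  then show ?thesis
    unfolding ex_bloch_mode_iff_det[OF l False] det_bloch_matrix[OF l, symmetric] using l by simp
next
  case True
  define A where "A = complex_of_real \<alpha>"
  define e where "e = (-1 :: complex) ^ N"
  have F: "Fp N \<Omega> = 1" "Fm N \<Omega> = 1" "Gp N \<Omega> = 1" "Gm N \<Omega> = 1"
    using True by (simp_all add: Fp_eq Fm_eq Gp_eq Gm_eq pade_0)
  \<comment> \<open>At \<Omega> = 0 all Kummer values are 1 and the expression factors; (l - 1)^2
    accounts for the constant modes, the last factor for the Legendre modes.\<close>
  have "l\<^sup>2 * (coef_a N \<alpha> \<Omega> * (l + 1 / l)\<^sup>2 + coef_b N \<alpha> \<Omega> * (l + 1 / l) + coef_c N \<alpha> \<Omega>)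
     = e * (l - 1)\<^sup>2 * ((1 + l * e)\<^sup>2 - (A * (1 - l * e))\<^sup>2)"
  proof -
    consider "e = 1" | "e = -1"
      unfolding e_def by (cases "even N") auto
    then show ?thesis
      unfolding symmetric_quadratic[OF l] coef_a_def coef_b_def coef_c_def F
        e_def[symmetric] A_def[symmetric]
      by cases (simp_all add: algebra_simps power2_eq_square)
  qed
  moreover have "e \<noteq> 0" by (simp add: e_def)
  ultimately have "l\<^sup>2 * (coef_a N \<alpha> \<Omega> * (l + 1 / l)\<^sup>2 + coef_b N \<alpha> \<Omega> * (l + 1 / l) + coef_c N \<alpha> \<Omega>) = 0
     \<longleftrightarrow> l = 1 \<or> (1 + l * e)\<^sup>2 = (A * (1 - l * e))\<^sup>2"
    by simp
  then have "coef_a N \<alpha> \<Omega> * (l + 1 / l)\<^sup>2 + coef_b N \<alpha> \<Omega> * (l + 1 / l) + coef_c N \<alpha> \<Omega> = 0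
     \<longleftrightarrow> l = 1 \<or> (1 + l * e)\<^sup>2 = (A * (1 - l * e))\<^sup>2"
    using l by simp
  then show ?thesis
    using ex_bloch_mode_0_iff[OF l, of N A] True by (simp add: A_def e_def)
qed

text \<open>The Kummer polynomials have real coefficients and \<Omega> is real, so conjugation
  exchanges the plus and minus values; each coefficient is symmetric under this exchange.\<close>

lemma coef_real: "coef_a N \<alpha> \<Omega> \<in> \<real>" "coef_b N \<alpha> \<Omega> \<in> \<real>" "coef_c N \<alpha> \<Omega> \<in> \<real>"
proof -
  have "cnj (Fp N \<Omega>) = Fm N \<Omega>" "cnj (Fm N \<Omega>) = Fp N \<Omega>" "cnj (Gp N \<Omega>) = Gm N \<Omega>" "cnj (Gm N \<Omega>) = Gp N \<Omega>"
    by (simp_all add: Fp_eq Fm_eq Gp_eq Gm_eq cnj_pade)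
  then show "coef_a N \<alpha> \<Omega> \<in> \<real>" "coef_b N \<alpha> \<Omega> \<in> \<real>" "coef_c N \<alpha> \<Omega> \<in> \<real>"
    unfolding Reals_cnj_iff coef_a_def coef_b_def coef_c_def by (simp_all add: algebra_simps)
qed

subsection \<open>Reduction of the scheme to the reference cell\<close>

lemma ex_antiderivative_poly: "\<exists>q. pderiv q = (p :: complex poly)"
proof
  let ?q = "\<Sum>i\<le>degree p. monom (coeff p i / of_nat (Suc i)) (Suc i)"
  show "pderiv ?q = p"
  proof (rule poly_eqI)
    fix n
    have "of_nat (Suc n) * coeff ?q (Suc n)
       = (\<Sum>i\<le>degree p. if i = n then of_nat (Suc n) * (coeff p n / of_nat (Suc n)) else 0)"
      unfolding coeff_sum sum_distrib_left by (intro sum.cong) auto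
    also have "\<dots> = coeff p n"
      by (simp add: coeff_eq_0 del: of_nat_Suc)
    finally show "coeff (pderiv ?q) n = coeff p n"
      by (simp add: coeff_pderiv)
  qed
qed

text \<open>The affine map from [0, 1] onto the closed cell is encoded as a polynomial, so that
  changing variables is \<open>pcompose\<close>.\<close>

definition cell_map :: "real \<Rightarrow> int \<Rightarrow> complex poly" where
  "cell_map h j = [:of_real (node h j), of_real h:]"

lemma node_Suc: "node h (j + 1) = node h j + h"
  by (simp add: node_def algebra_simps)

lemma poly_cell_map: "poly (cell_map h j) 0 = of_real (node h j)"
  "poly (cell_map h j) 1 = of_real (node h (j + 1))"
  by (simp_all add: cell_map_def node_Suc)

lemma pderiv_pcompose_cell_map:
  "pderiv (pcompose p (cell_map h j)) = smult (of_real h) (pcompose (pderiv p) (cell_map h j))"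
  by (simp add: pderiv_pcompose cell_map_def pderiv_pCons)

text \<open>Both integrals are boundary differences of one antiderivative; the factor
  \<open>h\<close> comes from the chain rule.\<close>

lemma integral_cell_poly:
  assumes "h > 0"
  shows "integral (cell h j) (\<lambda>x. poly p (of_real x)) = of_real h * unit_integral (pcompose p (cell_map h j))"
proof -
  obtain q where q: "pderiv q = p" using ex_antiderivative_poly by blast
  have "node h j \<le> node h (j + 1)" using assms by (simp add: node_Suc)
  then have "integral (cell h j) (\<lambda>x. poly p (of_real x)) = poly q (of_real (node h (j + 1))) - poly q (of_real (node h j))"
    unfolding cell_def integral_open_interval_real[symmetric] q[symmetric]
    by (intro integral_unique pderiv_has_integral)
  also have "\<dots> = unit_integral (pderiv (pcompose q (cell_map h j)))"
    by (simp add: unit_integral_pderiv poly_pcompose poly_cell_map)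
  finally show ?thesis
    by (simp add: pderiv_pcompose_cell_map unit_integral_smult q)
qed

lemma space_deriv_cell:
  assumes "\<And>x. x \<in> cell h j \<Longrightarrow> v x = poly q (of_real x)" "x \<in> cell h j"
  shows "space_deriv v x = poly (pderiv q) (of_real x)"
  unfolding space_deriv_def
proof (rule vector_derivative_at)
  have "open (cell h j)" by (simp add: cell_def)
  then show "(v has_vector_derivative poly (pderiv q) (of_real x)) (at x)"
    using assms
    by (intro has_vector_derivative_transform_within_open[OF poly_of_real_has_vector_derivative]) auto
qed

text \<open>A one-sided limit at the node sees only points of the adjacent cell.\<close>

lemma right_trace_cell:
  assumes "h > 0" and f: "\<And>x. x \<in> cell h j \<Longrightarrow> f x = poly q (of_real x)"
  shows "right_trace f (node h j) = poly (pcompose q (cell_map h j)) 0"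
proof -
  have "\<forall>\<^sub>F x in at_right (node h j). x \<in> cell h j"
    unfolding cell_def using assms by (intro eventually_at_rightI[of _ "node h (j + 1)"]) (auto simp: node_Suc)
  then have "\<forall>\<^sub>F x in at_right (node h j). poly q (of_real x) = f x"
    by eventually_elim (simp add: f)
  moreover have "((\<lambda>x. poly q (of_real x)) \<longlongrightarrow> poly q (of_real (node h j))) (at_right (node h j))"
    by (intro tendsto_intros)
  ultimately have "(f \<longlongrightarrow> poly q (of_real (node h j))) (at_right (node h j))"
    using Lim_transform_eventually by blast
  then show ?thesis
    unfolding right_trace_def by (simp add: tendsto_Lim poly_pcompose poly_cell_map)
qed

lemma left_trace_cell:
  assumes "h > 0" and f: "\<And>x. x \<in> cell h j \<Longrightarrow> f x = poly q (of_real x)"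
  shows "left_trace f (node h (j + 1)) = poly (pcompose q (cell_map h j)) 1"
proof -
  have "\<forall>\<^sub>F x in at_left (node h (j + 1)). x \<in> cell h j"
    unfolding cell_def using assms by (intro eventually_at_leftI[of "node h j"]) (auto simp: node_Suc)
  then have "\<forall>\<^sub>F x in at_left (node h (j + 1)). poly q (of_real x) = f x"
    by eventually_elim (simp add: f)
  moreover have "((\<lambda>x. poly q (of_real x)) \<longlongrightarrow> poly q (of_real (node h (j + 1)))) (at_left (node h (j + 1)))"
    by (intro tendsto_intros)
  ultimately have "(f \<longlongrightarrow> poly q (of_real (node h (j + 1)))) (at_left (node h (j + 1)))"
    using Lim_transform_eventually by blast
  then show ?thesis
    unfolding left_trace_def by (simp add: tendsto_Lim poly_pcompose poly_cell_map)
qed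

section \<open>Bloch waves on a single cell\<close>

definition cell_extend :: "real \<Rightarrow> complex poly \<Rightarrow> real \<Rightarrow> complex" where
  "cell_extend h p = (\<lambda>x. if x \<in> cell h 0 then poly p (of_real x) else 0)"

lemma cell_shift_iff: "x - of_int m * h \<in> cell h 0 \<longleftrightarrow> x \<in> cell h m"
  by (auto simp: cell_def node_def algebra_simps)

lemma cell_unique:
  assumes "x \<in> cell h i" "x \<in> cell h j"
  shows "i = j"
proof -
  have h: "h > 0" using assms(1) by (auto simp: cell_def node_Suc)
  have "(of_int i - of_int j) * h < 1 * h" "(of_int j - of_int i) * h < 1 * h"
    using assms by (auto simp: cell_def node_def algebra_simps)
  then have "(of_int i - of_int j :: real) < 1" "(of_int j - of_int i :: real) < 1"
    using h by (simp_all only: mult_less_cancel_right_pos)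
  then show ?thesis by linarith
qed

text \<open>Cells are disjoint, so only the term \<open>m = j\<close> of the infinite sum survives;
  on the cell the wave is a translated polynomial times a scalar.\<close>

lemma bloch_wave_cell:
  assumes x: "x \<in> cell h j"
  shows "bloch_wave h \<omega> l (cell_extend h p) x t
    = poly (smult (exp (- \<i> * of_real \<omega> * of_real t) * l powi j) (pcompose p [:- of_real (of_int j * h), 1:])) (of_real x)"
proof -
  have "(\<Sum>\<^sub>\<infinity>m. l powi m * cell_extend h p (x - of_int m * h))
      = (\<Sum>\<^sub>\<infinity>m\<in>{j}. l powi m * cell_extend h p (x - of_int m * h))"
    using cell_unique[OF x] by (intro infsum_cong_neutral) (auto simp: cell_extend_def cell_shift_iff)
  also have "\<dots> = l powi j * poly p (of_real x - of_real (of_int j * h))"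
    using x by (simp add: cell_extend_def cell_shift_iff)
  finally show ?thesis
    unfolding bloch_wave_def by (simp add: poly_pcompose)
qed

text \<open>The spatial sum is a constant factor in time, so the formula holds at every
  \<open>x\<close>, nodes included.\<close>

lemma bloch_wave_has_vector_derivative:
  "((\<lambda>s. bloch_wave h \<omega> l U x s) has_vector_derivative - \<i> * of_real \<omega> * bloch_wave h \<omega> l U x t) (at t)"
  unfolding bloch_wave_def
  by (rule has_vector_derivative_real_field) (auto intro!: derivative_eq_intros)

text \<open>In reference coordinates the wave is the same polynomial on every cell, up to a scalar:
  the map of cell \<open>j\<close> followed by the shift by \<open>- j * h\<close> is the map of
  cell 0.\<close>

lemma pcompose_bloch:
  "pcompose (smult c (pcompose p [:- of_real (of_int j * h), 1:])) (cell_map h j) = smult c (pcompose p (cell_map h 0))"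
proof -
  have "pcompose [:- of_real (of_int j * h), 1:] (cell_map h j) = cell_map h 0"
    by (simp add: cell_map_def pcompose_pCons node_def algebra_simps)
  then show ?thesis
    by (simp add: pcompose_smult flip: pcompose_assoc)
qed

text \<open>At the node between cells \<open>j\<close> and \<open>j + 1\<close> the right trace
  carries one more factor \<open>l\<close> than the left one.\<close>

lemma flux_bloch_wave:
  fixes p q :: "complex poly"
  assumes h: "h > 0" and l: "l \<noteq> 0"
  shows "flux \<alpha> (\<lambda>x. bloch_wave h \<omega> l (cell_extend h p) x t) (\<lambda>x. bloch_wave h \<omega> l (cell_extend h q) x t) (node h (j + 1))
    = exp (- \<i> * of_real \<omega> * of_real t) * l powi j
      * bloch_flux (of_real \<alpha>) l (pcompose p (cell_map h 0)) (pcompose q (cell_map h 0))"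
proof -
  let ?E = "exp (- \<i> * of_real \<omega> * of_real t)"
  have tr: "left_trace (\<lambda>x. bloch_wave h \<omega> l (cell_extend h p) x t) (node h (j + 1))
        = ?E * l powi j * poly (pcompose p (cell_map h 0)) 1"
      "right_trace (\<lambda>x. bloch_wave h \<omega> l (cell_extend h p) x t) (node h (j + 1))
        = ?E * l powi (j + 1) * poly (pcompose p (cell_map h 0)) 0" for p
  proof -
    show "left_trace (\<lambda>x. bloch_wave h \<omega> l (cell_extend h p) x t) (node h (j + 1))
        = ?E * l powi j * poly (pcompose p (cell_map h 0)) 1"
      unfolding poly_smult[symmetric] pcompose_bloch[of _ p j h, symmetric]
      by (rule left_trace_cell[OF h]) (rule bloch_wave_cell)
    show "right_trace (\<lambda>x. bloch_wave h \<omega> l (cell_extend h p) x t) (node h (j + 1))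
        = ?E * l powi (j + 1) * poly (pcompose p (cell_map h 0)) 0"
      unfolding poly_smult[symmetric] pcompose_bloch[of _ p "j + 1" h, symmetric]
      by (rule right_trace_cell[OF h]) (rule bloch_wave_cell)
  qed
  have "l powi (j + 1) = l powi j * l"
    using l by (simp add: power_int_add)
  then show ?thesis
    unfolding flux_def mean_def jump_def tr bloch_flux_def
    by (simp add: algebra_simps add_divide_distrib diff_divide_distrib)
qed

lemma flux_bloch_wave':
  fixes p q :: "complex poly"
  assumes h: "h > 0" and l: "l \<noteq> 0"
  shows "flux \<alpha> (\<lambda>x. bloch_wave h \<omega> l (cell_extend h p) x t) (\<lambda>x. bloch_wave h \<omega> l (cell_extend h q) x t) (node h j)
    = exp (- \<i> * of_real \<omega> * of_real t) * l powi j
      * (bloch_flux (of_real \<alpha>) l (pcompose p (cell_map h 0)) (pcompose q (cell_map h 0)) / l)"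
  using flux_bloch_wave[OF h l, of \<alpha> \<omega> p t q "j - 1"] l
  by (simp add: power_int_diff)

text \<open>On the reference cell the time term keeps a factor \<open>h\<close>, which joins
  \<open>\<omega>\<close>, while in the other volume term it cancels against the derivative. In the
  second equation all spatial terms have the opposite sign, so extracting \<open>- E\<close> leaves
  the weak form with \<open>z\<close> negated.\<close>

lemma weak_form_bloch_wave:
  fixes p q w :: "complex poly" and v :: "real \<Rightarrow> complex" and h \<omega> \<alpha> t :: real and j :: int and l :: complex
  assumes h: "h > 0" and l: "l \<noteq> 0"
    and v: "\<And>x. x \<in> cell h j \<Longrightarrow> v x = poly w (of_real x)"
  defines "u \<equiv> bloch_wave h \<omega> l (cell_extend h p)" and "\<phi> \<equiv> bloch_wave h \<omega> l (cell_extend h q)"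
    and "P \<equiv> pcompose p (cell_map h 0)"
    and "R \<equiv> bloch_flux (of_real \<alpha>) l (pcompose p (cell_map h 0)) (pcompose q (cell_map h 0))"
    and "E \<equiv> exp (- \<i> * of_real \<omega> * of_real t) * l powi j"
  shows "integral (cell h j) (\<lambda>x. time_deriv u x t * v x)
          - integral (cell h j) (\<lambda>x. u x t * space_deriv v x)
          + flux \<alpha> (\<lambda>x. u x t) (\<lambda>x. \<phi> x t) (node h (j + 1)) * left_trace v (node h (j + 1))
          - flux \<alpha> (\<lambda>x. u x t) (\<lambda>x. \<phi> x t) (node h j) * right_trace v (node h j)
     = E * weak_form (\<i> * of_real (\<omega> * h)) P R (R / l) (pcompose w (cell_map h j))" (is ?eq1)
    and "integral (cell h j) (\<lambda>x. time_deriv u x t * v x)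
          + integral (cell h j) (\<lambda>x. u x t * space_deriv v x)
          - flux \<alpha> (\<lambda>x. u x t) (\<lambda>x. \<phi> x t) (node h (j + 1)) * left_trace v (node h (j + 1))
          + flux \<alpha> (\<lambda>x. u x t) (\<lambda>x. \<phi> x t) (node h j) * right_trace v (node h j)
     = - E * weak_form (- (\<i> * of_real (\<omega> * h))) P R (R / l) (pcompose w (cell_map h j))" (is ?eq2)
proof -
  define r where "r = smult E (pcompose p [:- of_real (of_int j * h), 1:])"
  have u: "u x t = poly r (of_real x)" if "x \<in> cell h j" for x
    unfolding u_def r_def E_def using bloch_wave_cell[OF that] .
  have r: "pcompose r (cell_map h j) = smult E P"
    unfolding r_def P_def by (rule pcompose_bloch)
  have "integral (cell h j) (\<lambda>x. time_deriv u x t * v x)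
      = integral (cell h j) (\<lambda>x. poly (smult (- \<i> * of_real \<omega>) (r * w)) (of_real x))"
  proof (rule integral_cong)
    fix x assume x: "x \<in> cell h j"
    have "time_deriv u x t = - \<i> * of_real \<omega> * u x t"
      unfolding time_deriv_def u_def by (rule vector_derivative_at) (rule bloch_wave_has_vector_derivative)
    then show "time_deriv u x t * v x = poly (smult (- \<i> * of_real \<omega>) (r * w)) (of_real x)"
      using x by (simp add: u v)
  qed
  also have "\<dots> = E * (- (\<i> * of_real (\<omega> * h)) * unit_integral (P * pcompose w (cell_map h j)))"
    unfolding integral_cell_poly[OF h] pcompose_smult pcompose_mult r mult_smult_left unit_integral_smult
    by simp
  finally have i1: "integral (cell h j) (\<lambda>x. time_deriv u x t * v x)
      = E * (- (\<i> * of_real (\<omega> * h)) * unit_integral (P * pcompose w (cell_map h j)))" .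
  have "integral (cell h j) (\<lambda>x. u x t * space_deriv v x)
      = integral (cell h j) (\<lambda>x. poly (r * pderiv w) (of_real x))"
    by (rule integral_cong) (simp add: u space_deriv_cell[OF v])
  also have "\<dots> = E * unit_integral (P * pderiv (pcompose w (cell_map h j)))"
    unfolding integral_cell_poly[OF h] pcompose_mult r pderiv_pcompose_cell_map
    by (simp add: unit_integral_smult)
  finally have i2: "integral (cell h j) (\<lambda>x. u x t * space_deriv v x)
      = E * unit_integral (P * pderiv (pcompose w (cell_map h j)))" .
  have tr: "left_trace v (node h (j + 1)) = poly (pcompose w (cell_map h j)) 1"
    "right_trace v (node h j) = poly (pcompose w (cell_map h j)) 0"
    by (rule left_trace_cell[OF h] right_trace_cell[OF h], rule v, assumption)+
  show ?eq1 ?eq2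
    unfolding i1 i2 tr weak_form_def
    unfolding u_def \<phi>_def flux_bloch_wave[OF h l]
    unfolding flux_bloch_wave'[OF h l] E_def[symmetric] R_def[symmetric]
    by (simp_all add: algebra_simps)
qed

section \<open>Equivalence of the scheme and the mode equations\<close>

definition cell_inv :: "real \<Rightarrow> complex poly" where
  "cell_inv h = [:1 / 2, 1 / of_real h:]"

lemma cell_inv:
  assumes "h > 0"
  shows "pcompose (pcompose p (cell_inv h)) (cell_map h 0) = p"
    and "pcompose (pcompose p (cell_map h 0)) (cell_inv h) = p"
proof -
  have "pcompose (cell_inv h) (cell_map h 0) = [:0, 1:]" "pcompose (cell_map h 0) (cell_inv h) = [:0, 1:]"
    using assms by (simp_all add: cell_inv_def cell_map_def pcompose_pCons node_def)
  then show "pcompose (pcompose p (cell_inv h)) (cell_map h 0) = p"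
    "pcompose (pcompose p (cell_map h 0)) (cell_inv h) = p"
    by (simp_all flip: pcompose_assoc)
qed

lemma degree_pcompose_linear: "degree (pcompose p [:a, b :: complex:]) \<le> degree p"
  using degree_pcompose_le[of p "[:a, b:]"] by (cases "b = 0") auto

lemma bloch_wave_dg_space:
  assumes "degree p \<le> N"
  shows "(\<lambda>x. bloch_wave h \<omega> l (cell_extend h p) x t) \<in> dg_space h N"
  unfolding dg_space_def mem_Collect_eq
proof
  fix j
  show "\<exists>q. degree q \<le> N \<and> (\<forall>x\<in>cell h j. bloch_wave h \<omega> l (cell_extend h p) x t = poly q (of_real x))"
    using order_trans[OF order_trans[OF degree_smult_le degree_pcompose_linear] assms] bloch_wave_cell by blast
qed

text \<open>On each cell and at each time the scheme is the reference equation times a scalar, so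
  the mode equations imply it everywhere; conversely one cell at one time already yields
  them.\<close>

lemma dg_solution_bloch_wave_iff:
  assumes h: "h > 0" and l: "l \<noteq> 0" and p: "degree p \<le> N" and q: "degree q \<le> N"
  shows "dg_solution h N \<alpha> (bloch_wave h \<omega> l (cell_extend h p)) (bloch_wave h \<omega> l (cell_extend h q))
    \<longleftrightarrow> bloch_mode N (of_real \<alpha>) l (\<i> * of_real (\<omega> * h)) (pcompose p (cell_map h 0)) (pcompose q (cell_map h 0))"
    (is "?dg \<longleftrightarrow> ?mode")
proof -
  let ?P = "pcompose p (cell_map h 0)" and ?Q = "pcompose q (cell_map h 0)"
  let ?z = "\<i> * complex_of_real (\<omega> * h)" and ?A = "complex_of_real \<alpha>"
  let ?R = "bloch_flux ?A l ?P ?Q" and ?S = "bloch_flux ?A l ?Q ?P"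
  have deg: "degree ?P \<le> N" "degree ?Q \<le> N"
    using order_trans[OF degree_pcompose_linear] p q by (simp_all add: cell_map_def)
  have mode: "?mode \<longleftrightarrow> (\<forall>w. degree w \<le> N \<longrightarrow>
      weak_form ?z ?P ?R (?R / l) w = 0 \<and> weak_form (- ?z) ?Q ?S (?S / l) w = 0)"
    unfolding bloch_mode_def bloch_eq_def weak_iff_cell_eq[OF deg(1), symmetric]
      weak_iff_cell_eq[OF deg(2), symmetric]
    using deg by blast
  show ?thesis
  proof
    assume ?mode
    show ?dg
      unfolding dg_solution_def
    proof (intro conjI allI ballI)
      fix t j v \<psi> assume "v \<in> dg_space h N" "\<psi> \<in> dg_space h N"
      then obtain w1 w2 where w: "degree w1 \<le> N" "degree w2 \<le> N"
        and v: "\<And>x. x \<in> cell h j \<Longrightarrow> v x = poly w1 (of_real x)"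
          "\<And>x. x \<in> cell h j \<Longrightarrow> \<psi> x = poly w2 (of_real x)"
        unfolding dg_space_def by blast
      have "degree (pcompose w1 (cell_map h j)) \<le> N" "degree (pcompose w2 (cell_map h j)) \<le> N"
        using order_trans[OF degree_pcompose_linear] w by (simp_all add: cell_map_def)
      then have "weak_form ?z ?P ?R (?R / l) (pcompose w1 (cell_map h j)) = 0"
        "weak_form (- ?z) ?Q ?S (?S / l) (pcompose w2 (cell_map h j)) = 0"
        using \<open>?mode\<close> unfolding mode by blast+
      then show "integral (cell h j) (\<lambda>x. time_deriv (bloch_wave h \<omega> l (cell_extend h p)) x t * v x)
          - integral (cell h j) (\<lambda>x. bloch_wave h \<omega> l (cell_extend h p) x t * space_deriv v x)
          + flux \<alpha> (\<lambda>x. bloch_wave h \<omega> l (cell_extend h p) x t) (\<lambda>x. bloch_wave h \<omega> l (cell_extend h q) x t) (node h (j + 1)) * left_trace v (node h (j + 1))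
          - flux \<alpha> (\<lambda>x. bloch_wave h \<omega> l (cell_extend h p) x t) (\<lambda>x. bloch_wave h \<omega> l (cell_extend h q) x t) (node h j) * right_trace v (node h j) = 0"
        "integral (cell h j) (\<lambda>x. time_deriv (bloch_wave h \<omega> l (cell_extend h q)) x t * \<psi> x)
          + integral (cell h j) (\<lambda>x. bloch_wave h \<omega> l (cell_extend h q) x t * space_deriv \<psi> x)
          - flux \<alpha> (\<lambda>x. bloch_wave h \<omega> l (cell_extend h q) x t) (\<lambda>x. bloch_wave h \<omega> l (cell_extend h p) x t) (node h (j + 1)) * left_trace \<psi> (node h (j + 1))
          + flux \<alpha> (\<lambda>x. bloch_wave h \<omega> l (cell_extend h q) x t) (\<lambda>x. bloch_wave h \<omega> l (cell_extend h p) x t) (node h j) * right_trace \<psi> (node h j) = 0"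
        using weak_form_bloch_wave(1)[where v = v and j = j, OF h l v(1), of \<omega> p t \<alpha> q]
          weak_form_bloch_wave(2)[where v = \<psi> and j = j, OF h l v(2), of \<omega> q t \<alpha> p] by simp_all
    qed (rule bloch_wave_dg_space[OF p] bloch_wave_dg_space[OF q]
        differentiableI_vector[OF bloch_wave_has_vector_derivative])+
  next
    assume dg: ?dg
    show ?mode
      unfolding mode
    proof (intro allI impI)
      fix w :: "complex poly" assume "degree w \<le> N"
      \<comment> \<open>The test polynomial is carried over to cell 0 and used on the whole line,
        which puts it into the broken space.\<close>
      define v where "v = (\<lambda>x. poly (pcompose w (cell_inv h)) (complex_of_real x))"
      have "degree (pcompose w (cell_inv h)) \<le> N"
        using order_trans[OF degree_pcompose_linear \<open>degree w \<le> N\<close>] by (simp add: cell_inv_def)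
      then have vN: "v \<in> dg_space h N"
        unfolding v_def dg_space_def by blast
      have v: "v x = poly (pcompose w (cell_inv h)) (complex_of_real x)" if "x \<in> cell h 0" for x
        by (simp add: v_def)
      \<comment> \<open>At cell 0 and time 0 the scalar is 1; the same function tests both
        equations.\<close>
      note dg[unfolded dg_solution_def, THEN conjunct2, THEN conjunct2, THEN spec[of _ 0],
          THEN spec[of _ 0], THEN bspec[OF _ vN], THEN bspec[OF _ vN]]
      then show "weak_form ?z ?P ?R (?R / l) w = 0 \<and> weak_form (- ?z) ?Q ?S (?S / l) w = 0"
        using weak_form_bloch_wave(1)[where v = v and j = 0, OF h l v, of \<omega> p 0 \<alpha> q]
          weak_form_bloch_wave(2)[where v = v and j = 0, OF h l v, of \<omega> q 0 \<alpha> p]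
        unfolding cell_inv(1)[OF h] by simp
    qed
  qed
qed

text \<open>A cell has infinitely many points, so a nonzero polynomial cannot vanish on it; this
  carries non-triviality over to polynomials.\<close>

lemma cell_extend_eq_0_iff:
  assumes "h > 0"
  shows "cell_extend h p = (\<lambda>_. 0) \<longleftrightarrow> p = 0"
proof
  assume "cell_extend h p = (\<lambda>_. 0)"
  then have "poly p (of_real x) = 0" if "x \<in> cell h 0" for x
    using that by (metis cell_extend_def)
  then have "complex_of_real ` cell h 0 \<subseteq> {x. poly p x = 0}"
    by auto
  moreover have "infinite (complex_of_real ` cell h 0)"
    using assms by (subst finite_image_iff) (auto simp: inj_on_def cell_def node_def)
  ultimately show "p = 0"
    using poly_roots_finite finite_subset by blast
qed (simp add: cell_extend_def fun_eq_iff)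

theorem theorem4p6:
  fixes N :: nat and h \<omega> \<Omega> \<alpha> :: real and l :: complex
  assumes "h > 0" and "\<Omega> = \<omega> * h" and "l \<noteq> 0"
  shows "((\<exists>U\<in>cell_poly h N. \<exists>\<Phi>\<in>cell_poly h N. (U, \<Phi>) \<noteq> (\<lambda>_. 0, \<lambda>_. 0) \<and>
            dg_solution h N \<alpha> (bloch_wave h \<omega> l U) (bloch_wave h \<omega> l \<Phi>))
          \<longleftrightarrow> coef_a N \<alpha> \<Omega> * (l + 1 / l)\<^sup>2 + coef_b N \<alpha> \<Omega> * (l + 1 / l) + coef_c N \<alpha> \<Omega> = 0)
       \<and> 1 / l\<^sup>2 * det (bloch_matrix N \<alpha> \<Omega> l)
          = coef_a N \<alpha> \<Omega> * (l + 1 / l)\<^sup>2 + coef_b N \<alpha> \<Omega> * (l + 1 / l) + coef_c N \<alpha> \<Omega>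
       \<and> coef_a N \<alpha> \<Omega> \<in> \<real> \<and> coef_b N \<alpha> \<Omega> \<in> \<real> \<and> coef_c N \<alpha> \<Omega> \<in> \<real>"
proof -
  note h = \<open>h > 0\<close> and l = \<open>l \<noteq> 0\<close> and \<Omega> = \<open>\<Omega> = \<omega> * h\<close>
  let ?dg = "\<lambda>U \<Phi>. dg_solution h N \<alpha> (bloch_wave h \<omega> l U) (bloch_wave h \<omega> l \<Phi>)"
  let ?mode = "bloch_mode N (of_real \<alpha>) l (\<i> * of_real \<Omega>)"
  have "cell_poly h N = cell_extend h ` {p. degree p \<le> N}"
    by (auto simp: cell_poly_def cell_extend_def)
  then have "(\<exists>U\<in>cell_poly h N. \<exists>\<Phi>\<in>cell_poly h N. (U, \<Phi>) \<noteq> (\<lambda>_. 0, \<lambda>_. 0) \<and> ?dg U \<Phi>)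
    \<longleftrightarrow> (\<exists>p q. degree p \<le> N \<and> degree q \<le> N \<and> (p, q) \<noteq> (0, 0) \<and> ?dg (cell_extend h p) (cell_extend h q))"
    by (auto simp: cell_extend_eq_0_iff[OF h])
  also have "\<dots> \<longleftrightarrow> (\<exists>p q. degree p \<le> N \<and> degree q \<le> N \<and> (p, q) \<noteq> (0, 0) \<and>
      ?mode (pcompose p (cell_map h 0)) (pcompose q (cell_map h 0)))"
    using dg_solution_bloch_wave_iff[OF h l] unfolding \<Omega> by blast
  \<comment> \<open>Composition with \<open>cell_map h 0\<close> is invertible and respects the
    degree bound and zero, so \<open>P\<close>, \<open>Q\<close> range over the same pairs.\<close>
  also have "\<dots> \<longleftrightarrow> (\<exists>P Q. (P, Q) \<noteq> (0, 0) \<and> ?mode P Q)"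
  proof
    assume "\<exists>p q. degree p \<le> N \<and> degree q \<le> N \<and> (p, q) \<noteq> (0, 0) \<and>
      ?mode (pcompose p (cell_map h 0)) (pcompose q (cell_map h 0))"
    then obtain p q where "(p, q) \<noteq> (0, 0)" "?mode (pcompose p (cell_map h 0)) (pcompose q (cell_map h 0))"
      by blast
    then show "\<exists>P Q. (P, Q) \<noteq> (0, 0) \<and> ?mode P Q"
      using cell_inv(2)[OF h] by (metis Pair_inject pcompose_0)
  next
    assume "\<exists>P Q. (P, Q) \<noteq> (0, 0) \<and> ?mode P Q"
    then obtain P Q where nz: "(P, Q) \<noteq> (0, 0)" and m: "?mode P Q"
      by blast
    have "degree (pcompose P (cell_inv h)) \<le> N" "degree (pcompose Q (cell_inv h)) \<le> N"
      using m order_trans[OF degree_pcompose_linear] by (simp_all add: bloch_mode_def cell_inv_def)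
    moreover have "(pcompose P (cell_inv h), pcompose Q (cell_inv h)) \<noteq> (0, 0)"
      using nz cell_inv(1)[OF h] by (metis Pair_inject pcompose_0)
    ultimately show "\<exists>p q. degree p \<le> N \<and> degree q \<le> N \<and> (p, q) \<noteq> (0, 0) \<and>
      ?mode (pcompose p (cell_map h 0)) (pcompose q (cell_map h 0))"
      using m cell_inv(1)[OF h] by metis
  qed
  finally show ?thesis
    using ex_bloch_mode_iff[OF l] det_bloch_matrix[OF l] coef_real by simp
qed

end
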